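(* Let $d>1$ be an integer, $\mu\ge0$, and let $\Psi=\{\psi_\xi\}_{\xi\in\mathcal{X}}$ be the needlet system on $B^d$ with weight $W_\mu$. If $f\in L^2(B^d,W_\mu)$, then $$ f=\sum_{j=0}^\infty\sum_{\xi\in\mathcal{X}_j}\langle f,\psi_\xi\rangle\psi_\xi=\sum_{\xi\in\mathcal{X}}\langle f,\psi_\xi\rangle\psi_\xi\quad\text{in }L^2(B^d,W_\mu) $$ and $$ \|f\|_{L^2(B^d,W_\mu)}=\Big(\sum_{\xi\in\mathcal{X}}|\langle f,\psi_\xi\rangle|^2\Big)^{1/2}. $$
   Context: $B^d$ is the closed unit ball of $\mathbb{R}^d$, $|\cdot|$ the Euclidean norm, $W_\mu(x)=(1-|x|^2)^{\mu-1/2}$. On $L^2(B^d,W_\mu)$ the inner product is $\langle f,g\rangle=\int_{B^d}f(x)\overline{g(x)}W_\mu(x)\,dx$, with the corresponding norm. $d(x,y)=\arccos\{\langle x,y\rangle+\sqrt{1-|x|^2}\sqrt{1-|y|^2}\}$ for $x,y\in B^d$ and $B_\xi(r)=\{x\in B^d:d(x,\xi)\le r\}$. $\mathcal{V}_n^d$ is the space of polynomials of degree $n$ in $d$ variables orthogonal in $L^2(B^d,W_\mu)$ to all polynomials of lower degree. With $(b_d^\mu)^{-1}=\int_{B^d}W_\mu(x)\,dx$, $P_n(W_\mu;x,y)$ is the polynomial kernel for which the orthogonal projector onto $\mathcal{V}_n^d$ is $(\operatorname{Proj}_nf)(x)=b_d^\mu\int_{B^d}f(y)P_n(W_\mu;x,y)W_\mu(y)\,dy$.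 $\widehat a$ is a function with $\widehat a\in C^\infty[0,\infty)$, $\widehat a\ge0$, $\operatorname{supp}\widehat a\subset[1/2,2]$; $\widehat a(t)>c>0$ for $t\in[3/5,5/3]$; and $\widehat a^2(t)+\widehat a^2(2t)=1$ for $t\in[1/2,1]$. Kernels: $L_0(x,y):=b_d^\mu$ and $L_j(x,y):=b_d^\mu\sum_{\nu=0}^\infty\widehat a\big(\nu/2^{j-1}\big)P_\nu(W_\mu;x,y)$, $j=1,2,\dots$. Cubature: for each $j\ge0$, $\mathcal{X}_j\subset B^d$ is a finite set of almost uniformly $\varepsilon_j$-distributed points with $\varepsilon_j=c^\diamond2^{-j-2}$ ($c^\diamond>0$ a constant depending only on $d$ and $\mu$), and $\lambda_\xi>0$ ($\xi\in\mathcal{X}_j$) are coefficients such that $\int_{B^d}f(x)W_\mu(x)\,dx=\sum_{\xi\in\mathcal{X}_j}\lambda_\xi f(\xi)$ for all polynomials $f$ of total degree $\le2^{j+2}$, with $\lambda_\xi\sim\int_{B_\xi(2^{-j})}W_\mu(x)\,dx$ and $\#\mathcal{X}_j\sim2^{jd}$, where $A\sim B$ means $c_1A\le B\le c_2A$ with positive constants depending only on $d$ and $\mu$. Almost uniformly $\varepsilon$-distributed means: $\mathcal{X}_\varepsilon$ is the set of centers of the members of a partition $\mathcal{R}_\varepsilon$ of $B^d$ into non-overlapping projections (dropping the last coordinate) of spherical simplices in the upper hemisphere $S^d_+\subset\mathbb{R}^{d+1}$, such that each $R\in\mathcal{R}_\varepsilon$ has a unique $\xi\in\mathcal{X}_\varepsilon$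 with $B_\xi(c^*\varepsilon)\subset R\subset B_\xi(\varepsilon)$, and $\#\mathcal{X}_\varepsilon=\#\mathcal{R}_\varepsilon\le c^{**}\varepsilon^{-d}$, where $c^*,c^{**}>0$ are fixed constants depending only on $d$. Here a spherical simplex is $\{z/|z|:z\in\operatorname{conv}(w_1,\dots,w_{d+1})\}$ with $w_1,\dots,w_{d+1}$ linearly independent points of $\{z\in\mathbb{R}^{d+1}:s_iz_i\ge0\ \forall i,\ \sum_is_iz_i=1\}$ for some $s\in\{-1,1\}^{d+1}$ with $s_{d+1}=1$; its center is $w/|w|$, $w=\frac1{d+1}\sum_iw_i$, and the center of its projection is the projection of its center. Needlets: $\psi_\xi(x):=\sqrt{\lambda_\xi}\,L_j(x,\xi)$ for $\xi\in\mathcal{X}_j$, $j=0,1,\dots$. The index set is $\mathcal{X}:=\bigcup_{j\ge0}\mathcal{X}_j$, where points from different levels are regarded as different elements of $\mathcal{X}$ even if they coincide. *)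

theory Defs
  imports "HOL-Analysis.Analysis"
begin

section \<open>The weighted space \<open>L\<^sup>2(B\<^sup>d, W\<^sub>\<mu>)\<close>\<close>

abbreviation unit_ball :: "(real ^ 'd) set" where
  "unit_ball \<equiv> cball 0 1"

text \<open>
  Since \<open>0 powr a = 0\<close> in HOL, the value on the unit sphere is conventional; the sphere is a
  null set. The weight is only used on the unit ball.
\<close>

definition weight :: "real \<Rightarrow> real ^ 'd \<Rightarrow> real" where
  "weight \<mu> x = (1 - (norm x)\<^sup>2) powr (\<mu> - 1/2)"

definition weighted :: "real \<Rightarrow> (real ^ 'd) measure" where
  "weighted \<mu> = density (lebesgue_on unit_ball) (\<lambda>x. ennreal (weight \<mu> x))"

definition L2 :: "'a measure \<Rightarrow> ('a \<Rightarrow> complex) set" where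
  "L2 M = {f \<in> borel_measurable M. integrable M (\<lambda>x. (cmod (f x))\<^sup>2)}"

definition L2_inner :: "'a measure \<Rightarrow> ('a \<Rightarrow> complex) \<Rightarrow> ('a \<Rightarrow> complex) \<Rightarrow> complex" where
  "L2_inner M f g = (LINT x|M. f x * cnj (g x))"

definition L2_norm :: "'a measure \<Rightarrow> ('a \<Rightarrow> complex) \<Rightarrow> real" where
  "L2_norm M f = sqrt (LINT x|M. (cmod (f x))\<^sup>2)"

definition ball_const :: "'d::finite itself \<Rightarrow> real \<Rightarrow> real" where
  "ball_const _ \<mu> = inverse (LINT x:unit_ball|lebesgue. weight \<mu> (x :: real ^ 'd))"


section \<open>Polynomials and the projection kernels\<close>

definition multi_idx :: "nat \<Rightarrow> ('d::finite \<Rightarrow> nat) set" where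
  "multi_idx n = {k. (\<Sum>i\<in>UNIV. k i) \<le> n}"

definition monomial :: "('d::finite \<Rightarrow> nat) \<Rightarrow> real ^ 'd \<Rightarrow> complex" where
  "monomial k x = (\<Prod>i\<in>UNIV. complex_of_real (x $ i) ^ k i)"

text \<open>Polynomial functions of total degree at most \<open>n\<close>.\<close>

definition polys :: "nat \<Rightarrow> (real ^ 'd \<Rightarrow> complex) set" where
  "polys n = {p. \<exists>c. p = (\<lambda>x. \<Sum>k\<in>multi_idx n. c k * monomial k x)}"

text \<open>As usual for a linear space of polynomials \<open>of degree n\<close>, zero is included.\<close>

definition orth_polys :: "real \<Rightarrow> nat \<Rightarrow> (real ^ 'd \<Rightarrow> complex) set" where
  "orth_polys \<mu> n = {p \<in> polys n. \<forall>m<n. \<forall>q\<in>polys m. L2_inner (weighted \<mu>) p q = 0}"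

definition is_orth_proj ::
  "real \<Rightarrow> nat \<Rightarrow> (real ^ 'd \<Rightarrow> complex) \<Rightarrow> (real ^ 'd \<Rightarrow> complex) \<Rightarrow> bool" where
  "is_orth_proj \<mu> n f p \<longleftrightarrow> p \<in> orth_polys \<mu> n \<and>
     (\<forall>q\<in>orth_polys \<mu> n. L2_inner (weighted \<mu>) (\<lambda>x. f x - p x) q = 0)"

definition poly_kernel :: "(real ^ 'd \<Rightarrow> real ^ 'd \<Rightarrow> complex) \<Rightarrow> bool" where
  "poly_kernel P \<longleftrightarrow> (\<exists>N c. P =
     (\<lambda>x y. \<Sum>k\<in>multi_idx N. \<Sum>l\<in>multi_idx N. c k l * monomial k x * monomial l y))"

text \<open>
  A polynomial kernel representing the projector is unique, because a polynomial vanishing almost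
  everywhere on the ball is zero; so the choice operator denotes \<open>P\<^sub>n(W\<^sub>\<mu>; \<cdot>, \<cdot>)\<close>.
\<close>

definition proj_kernel :: "real \<Rightarrow> nat \<Rightarrow> real ^ 'd \<Rightarrow> real ^ 'd \<Rightarrow> complex" where
  "proj_kernel \<mu> n = (SOME P. poly_kernel P \<and>
     (\<forall>f\<in>L2 (weighted \<mu>). is_orth_proj \<mu> n f
        (\<lambda>x. complex_of_real (ball_const TYPE('d) \<mu>) * (LINT y|weighted \<mu>. f y * P x y))))"


section \<open>Cutoff function and needlets\<close>

text \<open>\<open>C\<^sup>\<infinity>(S)\<close>, with one-sided derivatives at boundary points of an interval \<open>S\<close>.\<close>

definition smooth_on_set :: "real set \<Rightarrow> (real \<Rightarrow> real) \<Rightarrow> bool" where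
  "smooth_on_set S a \<longleftrightarrow> (\<exists>D :: nat \<Rightarrow> real \<Rightarrow> real. D 0 = a \<and>
     (\<forall>n. \<forall>t\<in>S. (D n has_real_derivative D (Suc n) t) (at t within S)))"

definition needlet_cutoff :: "(real \<Rightarrow> real) \<Rightarrow> bool" where
  "needlet_cutoff a \<longleftrightarrow>
     smooth_on_set {0..} a \<and>
     (\<forall>t\<ge>0. a t \<ge> 0) \<and>
     closure {t. t \<ge> 0 \<and> a t \<noteq> 0} \<subseteq> {1/2..2} \<and>
     (\<exists>c>0. \<forall>t\<in>{3/5..5/3}. a t > c) \<and>
     (\<forall>t\<in>{1/2..1}. (a t)\<^sup>2 + (a (2 * t))\<^sup>2 = 1)"

text \<open>The series has only finitely many nonzero terms, by the support condition on \<open>a\<close>.\<close>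

definition needlet_kernel ::
  "real \<Rightarrow> (real \<Rightarrow> real) \<Rightarrow> nat \<Rightarrow> real ^ 'd \<Rightarrow> real ^ 'd \<Rightarrow> complex" where
  "needlet_kernel \<mu> a j x y =
     (if j = 0 then complex_of_real (ball_const TYPE('d) \<mu>)
      else complex_of_real (ball_const TYPE('d) \<mu>) *
             (\<Sum>\<nu>. complex_of_real (a (real \<nu> / 2 ^ (j - 1))) * proj_kernel \<mu> \<nu> x y))"

text \<open>
  The needlet of the point \<open>\<xi>\<close> regarded as an element of the level \<open>j\<close>; \<open>lam j \<xi>\<close> is its
  cubature coefficient.
\<close>

definition needlet ::
  "real \<Rightarrow> (real \<Rightarrow> real) \<Rightarrow> (nat \<Rightarrow> real ^ 'd \<Rightarrow> real) \<Rightarrow> nat \<times> (real ^ 'd) \<Rightarrow> real ^ 'd \<Rightarrow> complex"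
  where
  "needlet \<mu> a lam = (\<lambda>(j, \<xi>) x.
     complex_of_real (sqrt (lam j \<xi>)) * needlet_kernel \<mu> a j x \<xi>)"


section \<open>Almost uniformly distributed points\<close>

definition ball_dist :: "real ^ 'd \<Rightarrow> real ^ 'd \<Rightarrow> real" where
  "ball_dist x y = arccos (x \<bullet> y + sqrt (1 - (norm x)\<^sup>2) * sqrt (1 - (norm y)\<^sup>2))"

definition dball :: "real ^ 'd \<Rightarrow> real \<Rightarrow> (real ^ 'd) set" where
  "dball \<xi> r = {x \<in> unit_ball. ball_dist x \<xi> \<le> r}"

text \<open>
  The space of dimension \<open>d + 1\<close> is \<open>(real ^ 'd) \<times> real\<close>, so that \<^term>\<open>fst\<close> drops the last
  coordinate. A spherical simplex is given by its set of vertices \<open>w\<^sub>1, \<dots>, w\<^sub>d\<^sub>+\<^sub>1\<close>, all in the same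
  face (with last sign \<open>+1\<close>) of the cross-polytope.
\<close>

definition simplex_vertices :: "((real ^ 'd) \<times> real) set \<Rightarrow> bool" where
  "simplex_vertices W \<longleftrightarrow> independent W \<and> card W = CARD('d) + 1 \<and>
     (\<exists>s :: 'd \<Rightarrow> real. range s \<subseteq> {-1, 1} \<and>
        (\<forall>(x, t)\<in>W. (\<forall>i. s i * x $ i \<ge> 0) \<and> t \<ge> 0 \<and> (\<Sum>i\<in>UNIV. s i * x $ i) + t = 1))"

definition spherical_simplex :: "((real ^ 'd) \<times> real) set \<Rightarrow> ((real ^ 'd) \<times> real) set" where
  "spherical_simplex W = (\<lambda>z. z /\<^sub>R norm z) ` (convex hull W)"

definition simplex_center :: "((real ^ 'd) \<times> real) set \<Rightarrow> (real ^ 'd) \<times> real" where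
  "simplex_center W = (let w = (1 / (real CARD('d) + 1)) *\<^sub>R (\<Sum>v\<in>W. v) in w /\<^sub>R norm w)"

definition ball_region :: "((real ^ 'd) \<times> real) set \<Rightarrow> (real ^ 'd) set" where
  "ball_region W = fst ` spherical_simplex W"

text \<open>
  The partition is represented by the family \<open>\<W>\<close> of the vertex sets of its members;
  \<open>non-overlapping\<close> means that the interiors are disjoint.
\<close>

definition almost_uniform :: "real \<Rightarrow> real \<Rightarrow> real \<Rightarrow> (real ^ 'd) set \<Rightarrow> bool" where
  "almost_uniform c\<^sub>1 c\<^sub>2 \<epsilon> X \<longleftrightarrow> (\<exists>\<W>. finite \<W> \<and>
     (\<forall>W\<in>\<W>. simplex_vertices W) \<and>
     (\<Union>W\<in>\<W>. ball_region W) = unit_ball \<and>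
     (\<forall>W\<in>\<W>. \<forall>W'\<in>\<W>. W \<noteq> W' \<longrightarrow>
        interior (ball_region W) \<inter> interior (ball_region W') = {}) \<and>
     X = (\<lambda>W. fst (simplex_center W)) ` \<W> \<and>
     (\<forall>W\<in>\<W>. \<exists>!\<xi>. \<xi> \<in> X \<and> dball \<xi> (c\<^sub>1 * \<epsilon>) \<subseteq> ball_region W \<and> ball_region W \<subseteq> dball \<xi> \<epsilon>) \<and>
     card X = card \<W> \<and>
     real (card \<W>) \<le> c\<^sub>2 * inverse \<epsilon> ^ CARD('d))"

text \<open>\<open>A \<sim> B\<close> with constants uniform over the index set.\<close>

definition comparable_on :: "'i set \<Rightarrow> ('i \<Rightarrow> real) \<Rightarrow> ('i \<Rightarrow> real) \<Rightarrow> bool" where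
  "comparable_on I A B \<longleftrightarrow> (\<exists>c\<^sub>1>0. \<exists>c\<^sub>2>0. \<forall>i\<in>I. c\<^sub>1 * A i \<le> B i \<and> B i \<le> c\<^sub>2 * A i)"

text \<open>Points of different levels are different indices even if they coincide.\<close>

definition needlet_index :: "(nat \<Rightarrow> (real ^ 'd) set) \<Rightarrow> (nat \<times> (real ^ 'd)) set" where
  "needlet_index X = (SIGMA j:UNIV. X j)"

text \<open>
  The parameters \<open>c\<^sub>1\<close>, \<open>c\<^sub>2\<close> belong to almost uniform distribution (inner radius and number of
  points); \<open>c\<^sub>3\<close> is the factor in the mesh size.
\<close>

definition needlet_cubature ::
  "real \<Rightarrow> real \<Rightarrow> real \<Rightarrow> real \<Rightarrow> (nat \<Rightarrow> (real ^ 'd) set) \<Rightarrow> (nat \<Rightarrow> real ^ 'd \<Rightarrow> real) \<Rightarrow> bool" where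
  "needlet_cubature \<mu> c\<^sub>1 c\<^sub>2 c\<^sub>3 X lam \<longleftrightarrow>
     (\<forall>j. finite (X j) \<and> X j \<subseteq> unit_ball \<and> almost_uniform c\<^sub>1 c\<^sub>2 (c\<^sub>3 / 2 ^ (j + 2)) (X j)) \<and>
     (\<forall>j. \<forall>\<xi>\<in>X j. lam j \<xi> > 0) \<and>
     (\<forall>j. \<forall>p\<in>polys (2 ^ (j + 2)).
        (LINT x|weighted \<mu>. p x) = (\<Sum>\<xi>\<in>X j. complex_of_real (lam j \<xi>) * p \<xi>)) \<and>
     comparable_on (needlet_index X) (\<lambda>(j, \<xi>). lam j \<xi>)
       (\<lambda>(j, \<xi>). LINT x:dball \<xi> (1 / 2 ^ j)|lebesgue. weight \<mu> x) \<and>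
     comparable_on UNIV (\<lambda>j. real (card (X j))) (\<lambda>j. 2 ^ (j * CARD('d)))"

end

theory Submission
  imports Defs
begin

text \<open>
  Let \<open>E\<^sub>\<nu>\<close> be an orthonormal basis of the orthogonal polynomials of degree \<open>\<nu>\<close>. On the ball the projection
  kernel times \<open>b\<^sub>d\<^sup>\<mu>\<close> is \<open>\<Sum>\<^sub>e e(x) cnj (e(y))\<close>, so that \<open>\<langle>f, \<psi>\<^sub>\<xi>\<rangle> = sqrt \<lambda>\<^sub>\<xi> p(\<xi>)\<close> for a polynomial \<open>p\<close> of degree at
  most \<open>2\<^sup>j\<close>, and the cubature formula applied to \<open>p cnj p\<close> turns the sum over the level \<open>j\<close> of
  \<open>\<bar>\<langle>f, \<psi>\<^sub>\<xi>\<rangle>\<bar>\<^sup>2\<close> into \<open>\<Sum>\<^sub>\<nu> a(\<nu> / 2\<^bsup>j-1\<^esup>)\<^sup>2 \<parallel>Proj\<^sub>\<nu> f\<parallel>\<^sup>2\<close>. The squares of the dilated cutoff functions add up to one and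
  polynomials are dense, whence Parseval's identity. Parseval's identity for all functions gives
  \<open>\<parallel>\<Sum>\<^sub>i\<^sub>\<in>\<^sub>F c\<^sub>i \<psi>\<^sub>i\<parallel>\<^sup>2 \<le> \<Sum>\<^sub>i\<^sub>\<in>\<^sub>F \<bar>c\<^sub>i\<bar>\<^sup>2\<close>, hence
  \<open>\<parallel>f - \<Sum>\<^sub>i\<^sub>\<in>\<^sub>F \<langle>f, \<psi>\<^sub>i\<rangle> \<psi>\<^sub>i\<parallel>\<^sup>2 \<le> \<parallel>f\<parallel>\<^sup>2 - \<Sum>\<^sub>i\<^sub>\<in>\<^sub>F \<bar>\<langle>f, \<psi>\<^sub>i\<rangle>\<bar>\<^sup>2\<close> for every finite \<open>F\<close>, and both expansions converge.
\<close>

section \<open>Square integrable functions\<close>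

lemma borel_measurable_cnj [measurable (raw)]:
  "g \<in> borel_measurable M \<Longrightarrow> (\<lambda>x. cnj (g x)) \<in> borel_measurable M"
  by (rule borel_measurable_continuous_on[OF linear_continuous_on[OF bounded_linear_cnj]])

lemma cmod_add_power2: "(cmod (z + w))\<^sup>2 = (cmod z)\<^sup>2 + (cmod w)\<^sup>2 + 2 * Re (z * cnj w)"
  unfolding cmod_power2 by (simp add: power2_eq_square algebra_simps)

lemma cmod_diff_power2: "(cmod (z - w))\<^sup>2 = (cmod z)\<^sup>2 - 2 * Re (z * cnj w) + (cmod w)\<^sup>2"
  unfolding cmod_power2 by (simp add: power2_eq_square algebra_simps)

lemma L2_cmult: "f \<in> L2 M \<Longrightarrow> (\<lambda>x. c * f x) \<in> L2 M"
  by (auto simp: L2_def norm_mult power_mult_distrib)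

text \<open>By AM-GM the product is dominated pointwise by the sum of the two squared moduli, and
  that sum is integrable.\<close>

lemma L2_mult_integrable:
  assumes f: "f \<in> L2 M" and g: "g \<in> L2 M"
  shows "integrable M (\<lambda>x. f x * cnj (g x))"
proof (rule Bochner_Integration.integrable_bound)
  show "integrable M (\<lambda>x. (cmod (f x))\<^sup>2 + (cmod (g x))\<^sup>2)"
    using f g by (simp add: L2_def)
  have "f \<in> borel_measurable M" "g \<in> borel_measurable M"
    using f g by (auto simp: L2_def)
  then show "(\<lambda>x. f x * cnj (g x)) \<in> borel_measurable M"
    by measurable
  show "AE x in M. norm (f x * cnj (g x)) \<le> norm ((cmod (f x))\<^sup>2 + (cmod (g x))\<^sup>2)"
  proof (rule AE_I2)
    fix x
    have "cmod (f x) * cmod (g x) \<le> (cmod (f x))\<^sup>2 + (cmod (g x))\<^sup>2"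
      using sum_squares_bound[of "cmod (f x)" "cmod (g x)"]
        mult_nonneg_nonneg[OF norm_ge_zero[of "f x"] norm_ge_zero[of "g x"]] by linarith
    then show "norm (f x * cnj (g x)) \<le> norm ((cmod (f x))\<^sup>2 + (cmod (g x))\<^sup>2)"
      by (simp add: norm_mult)
  qed
qed

lemma L2_add:
  assumes f: "f \<in> L2 M" and g: "g \<in> L2 M"
  shows "(\<lambda>x. f x + g x) \<in> L2 M"
proof -
  have [measurable]: "f \<in> borel_measurable M" "g \<in> borel_measurable M"
    using f g by (auto simp: L2_def)
  have "integrable M (\<lambda>x. (cmod (f x))\<^sup>2 + (cmod (g x))\<^sup>2 + 2 * Re (f x * cnj (g x)))"
    using f g L2_mult_integrable[OF f g]
    by (intro Bochner_Integration.integrable_add integrable_mult_right integrable_Re)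
      (auto simp: L2_def)
  also have "(\<lambda>x. (cmod (f x))\<^sup>2 + (cmod (g x))\<^sup>2 + 2 * Re (f x * cnj (g x))) =
      (\<lambda>x. (cmod (f x + g x))\<^sup>2)"
    by (simp only: cmod_add_power2)
  finally show ?thesis
    by (simp add: L2_def)
qed

lemma L2_zero: "(\<lambda>x. 0) \<in> L2 M"
  by (simp add: L2_def)

lemma L2_diff: "f \<in> L2 M \<Longrightarrow> g \<in> L2 M \<Longrightarrow> (\<lambda>x. f x - g x) \<in> L2 M"
  using L2_add[of f M "\<lambda>x. - 1 * g x"] L2_cmult[of g M "-1"] by simp

lemma L2_sum:
  assumes "\<And>i. i \<in> I \<Longrightarrow> g i \<in> L2 M"
  shows "(\<lambda>x. \<Sum>i\<in>I. g i x) \<in> L2 M"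
  using assms by (induction I rule: infinite_finite_induct) (auto simp: L2_zero L2_add)

lemma L2_lincomb:
  assumes "\<And>i. i \<in> I \<Longrightarrow> g i \<in> L2 M"
  shows "(\<lambda>x. \<Sum>i\<in>I. c i * g i x) \<in> L2 M"
  by (rule L2_sum) (simp add: assms L2_cmult)

text \<open>Agreement is asked only on \<open>space M\<close> because a needlet is identified with a
  polynomial only on the unit ball.\<close>

lemma L2_cong:
  assumes "f \<in> L2 M" "\<And>x. x \<in> space M \<Longrightarrow> f x = g x"
  shows "g \<in> L2 M"
  using assms measurable_cong[of M f g borel]
    Bochner_Integration.integrable_cong[of M M "\<lambda>x. (cmod (f x))\<^sup>2" "\<lambda>x. (cmod (g x))\<^sup>2"]
  by (auto simp: L2_def)

lemma L2_inner_commute: "L2_inner M g f = cnj (L2_inner M f g)"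
proof -
  have "cnj (L2_inner M f g) = (LINT x|M. cnj (f x * cnj (g x)))"
    unfolding L2_inner_def by (simp only: Bochner_Integration.integral_cnj)
  then show ?thesis
    by (simp add: L2_inner_def mult.commute)
qed

text \<open>Membership in \<open>L2 M\<close> guards against the default value 0 of the Bochner
  integral at non-integrable functions, which would break additivity. Scalar factors pass through
  that default value as well.\<close>

lemma L2_inner_add_left:
  assumes "f \<in> L2 M" "g \<in> L2 M" "h \<in> L2 M"
  shows "L2_inner M (\<lambda>x. f x + g x) h = L2_inner M f h + L2_inner M g h"
  using L2_mult_integrable[OF assms(1,3)] L2_mult_integrable[OF assms(2,3)]
  by (simp add: L2_inner_def distrib_right)

lemma L2_inner_diff_left:
  assumes "f \<in> L2 M" "g \<in> L2 M" "h \<in> L2 M"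
  shows "L2_inner M (\<lambda>x. f x - g x) h = L2_inner M f h - L2_inner M g h"
  using L2_mult_integrable[OF assms(1,3)] L2_mult_integrable[OF assms(2,3)]
  by (simp add: L2_inner_def left_diff_distrib)

lemma L2_inner_cmult_left: "L2_inner M (\<lambda>x. c * f x) h = c * L2_inner M f h"
  by (simp add: L2_inner_def mult.assoc)

lemma L2_inner_cmult_right: "L2_inner M f (\<lambda>x. c * h x) = cnj c * L2_inner M f h"
  by (simp add: L2_inner_def mult.left_commute)

lemma L2_inner_lincomb_left:
  assumes "\<And>i. i \<in> I \<Longrightarrow> g i \<in> L2 M" "h \<in> L2 M"
  shows "L2_inner M (\<lambda>x. \<Sum>i\<in>I. c i * g i x) h = (\<Sum>i\<in>I. c i * L2_inner M (g i) h)"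
proof -
  have "integrable M (\<lambda>x. c i * (g i x * cnj (h x)))" if "i \<in> I" for i
    using L2_mult_integrable[OF assms(1)[OF that] assms(2)] by simp
  then show ?thesis
    by (simp add: L2_inner_def sum_distrib_right mult.assoc)
qed

lemma L2_inner_lincomb_right:
  assumes "\<And>i. i \<in> I \<Longrightarrow> g i \<in> L2 M" "h \<in> L2 M"
  shows "L2_inner M h (\<lambda>x. \<Sum>i\<in>I. c i * g i x) = (\<Sum>i\<in>I. cnj (c i) * L2_inner M h (g i))"
proof -
  have "L2_inner M h (\<lambda>x. \<Sum>i\<in>I. c i * g i x) = cnj (\<Sum>i\<in>I. c i * L2_inner M (g i) h)"
    by (subst L2_inner_commute) (simp add: L2_inner_lincomb_left assms)
  then show ?thesis
    by (simp add: L2_inner_commute[of M h])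
qed

lemma L2_inner_cong_AE:
  assumes "f \<in> L2 M" "f' \<in> L2 M" "g \<in> L2 M" "g' \<in> L2 M"
    and "AE x in M. f x = f' x" "AE x in M. g x = g' x"
  shows "L2_inner M f g = L2_inner M f' g'"
  unfolding L2_inner_def using assms
  by (intro integral_cong_AE borel_measurable_integrable L2_mult_integrable) auto

lemma L2_norm_power2: "(L2_norm M f)\<^sup>2 = (LINT x|M. (cmod (f x))\<^sup>2)"
  by (simp add: L2_norm_def)

lemma L2_inner_self: "L2_inner M f f = complex_of_real ((L2_norm M f)\<^sup>2)"
proof -
  have "L2_inner M f f = (LINT x|M. complex_of_real ((cmod (f x))\<^sup>2))"
    unfolding L2_inner_def complex_norm_square ..
  then show ?thesis
    by (simp only: integral_complex_of_real L2_norm_power2)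
qed

lemma L2_norm_nonneg: "0 \<le> L2_norm M f"
  by (simp add: L2_norm_def)

lemma L2_norm_cong_AE:
  assumes "f \<in> L2 M" "g \<in> L2 M" "AE x in M. f x = g x"
  shows "L2_norm M f = L2_norm M g"
proof -
  have "(L2_norm M f)\<^sup>2 = (L2_norm M g)\<^sup>2"
    using L2_inner_cong_AE[of f M g f g] assms by (simp add: L2_inner_self del: of_real_power)
  then show ?thesis
    by (simp add: L2_norm_nonneg)
qed

lemma L2_norm_zero_imp_AE:
  assumes "f \<in> L2 M" "L2_norm M f = 0"
  shows "AE x in M. f x = 0"
proof -
  have "(LINT x|M. (cmod (f x))\<^sup>2) = 0"
    using assms(2) L2_norm_power2[of M f] by simp
  then have "AE x in M. (cmod (f x))\<^sup>2 = 0"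
    using assms(1) integral_nonneg_eq_0_iff_AE[of M "\<lambda>x. (cmod (f x))\<^sup>2"] by (auto simp: L2_def)
  then show ?thesis
    by simp
qed

lemma L2_norm_diff_power2:
  assumes "f \<in> L2 M" "g \<in> L2 M"
  shows "(L2_norm M (\<lambda>x. f x - g x))\<^sup>2 =
    (L2_norm M f)\<^sup>2 - 2 * Re (L2_inner M f g) + (L2_norm M g)\<^sup>2"
proof -
  have "(LINT x|M. (cmod (f x - g x))\<^sup>2) =
      (LINT x|M. (cmod (f x))\<^sup>2 - 2 * Re (f x * cnj (g x)) + (cmod (g x))\<^sup>2)"
    by (simp only: cmod_diff_power2)
  also have "\<dots> = (LINT x|M. (cmod (f x))\<^sup>2) - 2 * (LINT x|M. Re (f x * cnj (g x)))
      + (LINT x|M. (cmod (g x))\<^sup>2)"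
    using assms L2_mult_integrable[OF assms] by (simp add: L2_def del: times_complex.sel)
  also have "(LINT x|M. Re (f x * cnj (g x))) = Re (L2_inner M f g)"
    unfolding L2_inner_def using L2_mult_integrable[OF assms] by (rule integral_Re)
  finally show ?thesis
    by (simp add: L2_norm_power2)
qed

text \<open>A crude triangle inequality, integrated from the pointwise bound
  \<open>(a + b)\<^sup>2 \<le> 2 * a\<^sup>2 + 2 * b\<^sup>2\<close>. The factor 2 only enters the
  error budget of \<open>polys_dense\<close>.\<close>

lemma L2_norm_triangle_power2:
  assumes "f \<in> L2 M" "g \<in> L2 M"
  shows "(L2_norm M (\<lambda>x. f x + g x))\<^sup>2 \<le> 2 * (L2_norm M f)\<^sup>2 + 2 * (L2_norm M g)\<^sup>2"
proof -
  have "(LINT x|M. (cmod (f x + g x))\<^sup>2) \<le> (LINT x|M. 2 * (cmod (f x))\<^sup>2 + 2 * (cmod (g x))\<^sup>2)"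
  proof (rule integral_mono)
    show "integrable M (\<lambda>x. (cmod (f x + g x))\<^sup>2)"
      using L2_add[OF assms] by (simp add: L2_def)
    show "integrable M (\<lambda>x. 2 * (cmod (f x))\<^sup>2 + 2 * (cmod (g x))\<^sup>2)"
      using assms by (simp add: L2_def)
    fix x
    have "(cmod (f x + g x))\<^sup>2 \<le> (cmod (f x) + cmod (g x))\<^sup>2"
      by (simp add: norm_triangle_ineq power_mono)
    also have "\<dots> \<le> 2 * (cmod (f x))\<^sup>2 + 2 * (cmod (g x))\<^sup>2"
      using sum_squares_bound[of "cmod (f x)" "cmod (g x)"] by (simp add: power2_sum)
    finally show "(cmod (f x + g x))\<^sup>2 \<le> 2 * (cmod (f x))\<^sup>2 + 2 * (cmod (g x))\<^sup>2" .
  qed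
  also have "\<dots> = 2 * (LINT x|M. (cmod (f x))\<^sup>2) + 2 * (LINT x|M. (cmod (g x))\<^sup>2)"
    using assms by (simp add: L2_def)
  finally show ?thesis
    by (simp add: L2_norm_power2)
qed


section \<open>Finite orthonormal systems\<close>

text \<open>The family is indexed so as to cover both a set of functions, with the identity as
  family, and the disjoint union \<open>Sigma {..n} E\<close> of bases of several degrees, with
  \<open>snd\<close> as family.\<close>

definition orthonormal_on :: "'a measure \<Rightarrow> 'i set \<Rightarrow> ('i \<Rightarrow> 'a \<Rightarrow> complex) \<Rightarrow> bool" where
  "orthonormal_on M I e \<longleftrightarrow> finite I \<and> (\<forall>i\<in>I. e i \<in> L2 M) \<and>
     (\<forall>i\<in>I. \<forall>j\<in>I. L2_inner M (e i) (e j) = (if i = j then 1 else 0))"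

lemma orthonormal_onD:
  assumes "orthonormal_on M I e"
  shows "finite I" "i \<in> I \<Longrightarrow> e i \<in> L2 M"
    "i \<in> I \<Longrightarrow> j \<in> I \<Longrightarrow> L2_inner M (e i) (e j) = (if i = j then 1 else 0)"
  using assms by (auto simp: orthonormal_on_def)

lemma orthonormal_inner_lincomb:
  assumes "orthonormal_on M I e" "j \<in> I"
  shows "L2_inner M (\<lambda>x. \<Sum>i\<in>I. c i * e i x) (e j) = c j"
proof -
  have "L2_inner M (\<lambda>x. \<Sum>i\<in>I. c i * e i x) (e j) = (\<Sum>i\<in>I. c i * L2_inner M (e i) (e j))"
    using assms by (intro L2_inner_lincomb_left) (auto simp: orthonormal_onD(2))
  also have "\<dots> = (\<Sum>i\<in>I. if i = j then c i else 0)"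
    by (intro sum.cong) (use assms in \<open>auto simp: orthonormal_onD(3)\<close>)
  finally show ?thesis
    using assms by (simp add: orthonormal_onD(1))
qed

lemma orthonormal_norm_lincomb:
  assumes "orthonormal_on M I e"
  shows "(L2_norm M (\<lambda>x. \<Sum>i\<in>I. c i * e i x))\<^sup>2 = (\<Sum>i\<in>I. (cmod (c i))\<^sup>2)"
proof -
  note e = orthonormal_onD[OF assms]
  have "L2_inner M (\<lambda>x. \<Sum>i\<in>I. c i * e i x) (\<lambda>x. \<Sum>i\<in>I. c i * e i x) = (\<Sum>i\<in>I. cnj (c i) * c i)"
    by (subst L2_inner_lincomb_right) (auto simp: e L2_lincomb orthonormal_inner_lincomb[OF assms])
  also have "\<dots> = complex_of_real (\<Sum>i\<in>I. (cmod (c i))\<^sup>2)"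
    unfolding of_real_sum by (intro sum.cong) (simp_all only: complex_norm_square mult.commute)
  finally show ?thesis
    unfolding L2_inner_self of_real_eq_iff .
qed

text \<open>Completing the square in the coefficients. If \<open>d\<close> consists of the Fourier
  coefficients, the last sum vanishes and Bessel's inequality follows; for any other
  \<open>d\<close> that sum shows that the approximation is no better.\<close>

lemma orthonormal_norm_diff:
  assumes "orthonormal_on M I e" "f \<in> L2 M"
  shows "(L2_norm M (\<lambda>x. f x - (\<Sum>i\<in>I. d i * e i x)))\<^sup>2 =
    (L2_norm M f)\<^sup>2 - (\<Sum>i\<in>I. (cmod (L2_inner M f (e i)))\<^sup>2)
      + (\<Sum>i\<in>I. (cmod (L2_inner M f (e i) - d i))\<^sup>2)"
proof -
  note e = orthonormal_onD[OF assms(1)]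
  have "L2_inner M f (\<lambda>x. \<Sum>i\<in>I. d i * e i x) = (\<Sum>i\<in>I. cnj (d i) * L2_inner M f (e i))"
    by (rule L2_inner_lincomb_right) (use e assms in auto)
  moreover have "(\<Sum>i\<in>I. (cmod (L2_inner M f (e i) - d i))\<^sup>2) =
     (\<Sum>i\<in>I. (cmod (L2_inner M f (e i)))\<^sup>2) - 2 * Re (\<Sum>i\<in>I. cnj (d i) * L2_inner M f (e i))
      + (\<Sum>i\<in>I. (cmod (d i))\<^sup>2)"
    by (simp only: Re_sum sum_distrib_left sum_subtractf[symmetric] sum.distrib[symmetric]
        cmod_diff_power2 mult.commute[of "cnj _"])
  ultimately show ?thesis
    using assms(2) by (subst L2_norm_diff_power2)
      (auto simp: e L2_lincomb orthonormal_norm_lincomb[OF assms(1)])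
qed

text \<open>Induction over the generators, each one reduced by its expansion in the system found so
  far. A generator whose remainder has norm zero leaves the system unchanged, so dependent
  generators are allowed; its expansion then holds only almost everywhere, since functions and not
  classes are used.\<close>

lemma gram_schmidt:
  assumes add: "\<And>f g. f \<in> V \<Longrightarrow> g \<in> V \<Longrightarrow> (\<lambda>x. f x + g x) \<in> V"
    and scale: "\<And>f c. f \<in> V \<Longrightarrow> (\<lambda>x. c * f x) \<in> V"
    and V: "V \<subseteq> L2 M" and "finite G" "G \<subseteq> V"
  shows "\<exists>E. E \<subseteq> V \<and> orthonormal_on M E (\<lambda>e. e) \<and>
    (\<forall>g\<in>G. AE x in M. g x = (\<Sum>e\<in>E. L2_inner M g e * e x))"
  using \<open>finite G\<close> \<open>G \<subseteq> V\<close>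
proof (induction G)
  case empty
  then show ?case
    by (intro exI[of _ "{}"]) (simp add: orthonormal_on_def)
next
  case (insert g G)
  then obtain E where E: "E \<subseteq> V" "orthonormal_on M E (\<lambda>e. e)"
    "\<And>g. g \<in> G \<Longrightarrow> AE x in M. g x = (\<Sum>e\<in>E. L2_inner M g e * e x)"
    by auto
  have g: "g \<in> V" "g \<in> L2 M"
    using insert.prems V by auto
  note ortho = orthonormal_onD[OF E(2)]
  define r where "r = (\<lambda>x. g x - (\<Sum>e\<in>E. L2_inner M g e * e x))"
  have "(\<lambda>x. \<Sum>e\<in>E'. c e * e x) \<in> V" if "finite E'" "E' \<subseteq> V" for E' c
    using that
  proof induction
    case empty
    then show ?case using scale[OF g(1), of 0] by simp
  qed (auto intro!: add scale)
  from add[OF g(1) scale[OF this[OF ortho(1) E(1)], of "-1" "\<lambda>e. L2_inner M g e"]]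
  have rV: "r \<in> V"
    by (simp add: r_def)
  then have rL: "r \<in> L2 M"
    using V by auto
  have r_ortho: "L2_inner M r e = 0" if "e \<in> E" for e
    unfolding r_def using that ortho g
    by (subst L2_inner_diff_left) (auto intro!: L2_lincomb simp: orthonormal_inner_lincomb[OF E(2)])
  show ?case
  proof (cases "L2_norm M r = 0")
    case True
    have "AE x in M. g x = (\<Sum>e\<in>E. L2_inner M g e * e x)"
      using L2_norm_zero_imp_AE[OF rL True] by (simp add: r_def)
    then show ?thesis
      using E by (intro exI[of _ E]) auto
  next
    case False
    define s where "s = complex_of_real (inverse (L2_norm M r))"
    define u where "u = (\<lambda>x. s * r x)"
    have u: "u \<in> V" "u \<in> L2 M"
      using scale[OF rV] V by (auto simp: u_def)
    have rr: "L2_inner M r r * s * s = 1"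
      using False by (simp add: L2_inner_self s_def power2_eq_square field_simps)
    then have uu: "L2_inner M u u = 1"
      unfolding u_def L2_inner_cmult_left L2_inner_cmult_right
      by (simp add: s_def ac_simps)
    have ue1: "L2_inner M u e = 0" if "e \<in> E" for e
      unfolding u_def L2_inner_cmult_left r_ortho[OF that] by simp
    have ue2: "L2_inner M e u = 0" if "e \<in> E" for e
      unfolding L2_inner_commute[of M e u] ue1[OF that] by simp
    note ue = ue1 ue2
    have "u \<notin> E"
      using uu ue by force
    have "orthonormal_on M (insert u E) (\<lambda>e. e)"
      using ortho u uu ue \<open>u \<notin> E\<close> by (auto simp: orthonormal_on_def)
    \<comment> \<open>The earlier generators lie almost everywhere in the span of \<open>E\<close>,
      so their coefficient at the new vector \<open>u\<close> is zero and their expansions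
      persist.\<close>
    moreover have "AE x in M. h x = (\<Sum>e\<in>insert u E. L2_inner M h e * e x)" if "h \<in> G" for h
    proof -
      have h: "h \<in> L2 M"
        using that insert.prems V by auto
      have "L2_inner M h u = L2_inner M (\<lambda>x. \<Sum>e\<in>E. L2_inner M h e * e x) u"
        using E(3)[OF that] h u ortho by (intro L2_inner_cong_AE L2_lincomb) auto
      also have "\<dots> = 0"
        using u ortho by (subst L2_inner_lincomb_left) (auto simp: ue)
      finally show ?thesis
        using E(3)[OF that] ortho \<open>u \<notin> E\<close> by simp
    qed
    moreover have "AE x in M. g x = (\<Sum>e\<in>insert u E. L2_inner M g e * e x)"
    proof (rule AE_I2)
      fix x
      have "L2_inner M g u = L2_inner M (\<lambda>x. r x + (\<Sum>e\<in>E. L2_inner M g e * e x)) u"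
        by (simp add: r_def)
      also have "\<dots> = L2_inner M r u"
        using u rL ortho by (subst L2_inner_add_left)
          (auto intro!: L2_lincomb simp: L2_inner_lincomb_left ue)
      also have "\<dots> = L2_inner M r r * s"
        unfolding u_def L2_inner_cmult_right by (simp add: s_def)
      \<comment> \<open>The two factors \<open>s\<close>, one from the coefficient and one from
        \<open>u\<close>, cancel the squared norm of \<open>r\<close>, so the new term restores
        exactly the remainder that was split off.\<close>
      finally have "L2_inner M g u * u x = r x"
        using rr by (simp add: u_def flip: mult.assoc)
      then show "g x = (\<Sum>e\<in>insert u E. L2_inner M g e * e x)"
        using ortho \<open>u \<notin> E\<close> by (simp add: r_def)
    qed
    ultimately show ?thesis
      using E u by (intro exI[of _ "insert u E"]) auto
  qed
qed

text \<open>Passes from the generators to their span: finitely many exceptional null sets are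
  merged, and off their union the identity is linear in \<open>g\<close>.\<close>

lemma expansion_lincomb:
  assumes "orthonormal_on M E (\<lambda>e. e)" "finite G" "G \<subseteq> L2 M"
    and "\<forall>g\<in>G. AE x in M. g x = (\<Sum>e\<in>E. L2_inner M g e * e x)"
  shows "AE x in M. (\<Sum>g\<in>G. c g * g x) =
    (\<Sum>e\<in>E. L2_inner M (\<lambda>x. \<Sum>g\<in>G. c g * g x) e * e x)"
proof -
  have "AE x in M. \<forall>g\<in>G. g x = (\<Sum>e\<in>E. L2_inner M g e * e x)"
    using assms by (simp add: AE_finite_all)
  moreover have "L2_inner M (\<lambda>x. \<Sum>g\<in>G. c g * g x) e = (\<Sum>g\<in>G. c g * L2_inner M g e)" if "e \<in> E" for e
    using assms that by (intro L2_inner_lincomb_left) (auto dest: orthonormal_onD)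
  ultimately show ?thesis
  proof (elim AE_mp, intro AE_I2 impI)
    fix x
    assume ex: "\<forall>g\<in>G. g x = (\<Sum>e\<in>E. L2_inner M g e * e x)"
      and inner: "\<And>e. e \<in> E \<Longrightarrow>
        L2_inner M (\<lambda>x. \<Sum>g\<in>G. c g * g x) e = (\<Sum>g\<in>G. c g * L2_inner M g e)"
    have "(\<Sum>g\<in>G. c g * g x) = (\<Sum>g\<in>G. \<Sum>e\<in>E. c g * L2_inner M g e * e x)"
    proof (rule sum.cong[OF refl])
      fix g assume "g \<in> G"
      then have "g x = (\<Sum>e\<in>E. L2_inner M g e * e x)" using ex by blast
      then show "c g * g x = (\<Sum>e\<in>E. c g * L2_inner M g e * e x)"
        by (simp add: sum_distrib_left mult.assoc)
    qed
    also have "\<dots> = (\<Sum>e\<in>E. (\<Sum>g\<in>G. c g * L2_inner M g e) * e x)"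
      by (subst sum.swap) (simp add: sum_distrib_right)
    finally show "(\<Sum>g\<in>G. c g * g x) = (\<Sum>e\<in>E. L2_inner M (\<lambda>x. \<Sum>g\<in>G. c g * g x) e * e x)"
      by (simp add: inner)
  qed
qed

section \<open>Finite sums over a system that satisfies Bessel's inequality\<close>

text \<open>
  The norm of \<open>h = \<Sum>\<^sub>i c\<^sub>i \<psi>\<^sub>i\<close> is estimated through \<open>\<langle>h, h\<rangle> = \<Sum>\<^sub>i cnj c\<^sub>i \<langle>h, \<psi>\<^sub>i\<rangle>\<close> and AM-GM, after which half of
  \<open>\<parallel>h\<parallel>\<^sup>2\<close> is absorbed on the left.
\<close>

lemma frame_synthesis_bound:
  assumes "finite F" and psi: "\<And>i. i \<in> F \<Longrightarrow> \<psi> i \<in> L2 M"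
    and bessel: "\<And>h. h \<in> L2 M \<Longrightarrow> (\<Sum>i\<in>F. (cmod (L2_inner M h (\<psi> i)))\<^sup>2) \<le> (L2_norm M h)\<^sup>2"
  shows "(L2_norm M (\<lambda>x. \<Sum>i\<in>F. c i * \<psi> i x))\<^sup>2 \<le> (\<Sum>i\<in>F. (cmod (c i))\<^sup>2)"
proof -
  define h where "h = (\<lambda>x. \<Sum>i\<in>F. c i * \<psi> i x)"
  have h: "h \<in> L2 M"
    unfolding h_def by (rule L2_lincomb) (rule psi)
  have "complex_of_real ((L2_norm M h)\<^sup>2) = L2_inner M h h"
    by (simp add: L2_inner_self)
  also have "\<dots> = (\<Sum>i\<in>F. cnj (c i) * L2_inner M h (\<psi> i))"
    by (subst (2) h_def) (use psi h in \<open>intro L2_inner_lincomb_right\<close>)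
  finally have eq: "complex_of_real ((L2_norm M h)\<^sup>2) = (\<Sum>i\<in>F. cnj (c i) * L2_inner M h (\<psi> i))" .
  have "(L2_norm M h)\<^sup>2 = cmod (complex_of_real ((L2_norm M h)\<^sup>2))"
    by (simp add: norm_of_real del: of_real_power)
  also have "\<dots> \<le> (\<Sum>i\<in>F. cmod (c i) * cmod (L2_inner M h (\<psi> i)))"
    unfolding eq by (rule order_trans[OF norm_sum]) (simp add: norm_mult)
  also have "\<dots> \<le> (\<Sum>i\<in>F. ((cmod (c i))\<^sup>2 + (cmod (L2_inner M h (\<psi> i)))\<^sup>2) / 2)"
  proof (rule sum_mono)
    fix i
    show "cmod (c i) * cmod (L2_inner M h (\<psi> i)) \<le>
        ((cmod (c i))\<^sup>2 + (cmod (L2_inner M h (\<psi> i)))\<^sup>2) / 2"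
      using sum_squares_bound[of "cmod (c i)" "cmod (L2_inner M h (\<psi> i))"] by simp
  qed
  also have "\<dots> = (\<Sum>i\<in>F. (cmod (c i))\<^sup>2) / 2 + (\<Sum>i\<in>F. (cmod (L2_inner M h (\<psi> i)))\<^sup>2) / 2"
    by (simp add: sum.distrib sum_divide_distrib add_divide_distrib)
  finally show ?thesis
    using bessel[OF h] by (simp add: h_def)
qed

text \<open>In the expanded square the cross term is exactly minus twice the sum of the squared
  coefficients, and by \<open>frame_synthesis_bound\<close> the squared norm of the finite sum gives
  back at most one of these. Thus Bessel's inequality stands in for orthogonality of the
  \<open>\<psi> i\<close>.\<close>

lemma frame_remainder_bound:
  assumes "finite F" and psi: "\<And>i. i \<in> F \<Longrightarrow> \<psi> i \<in> L2 M" and f: "f \<in> L2 M"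
    and bessel: "\<And>h. h \<in> L2 M \<Longrightarrow> (\<Sum>i\<in>F. (cmod (L2_inner M h (\<psi> i)))\<^sup>2) \<le> (L2_norm M h)\<^sup>2"
  shows "(L2_norm M (\<lambda>x. f x - (\<Sum>i\<in>F. L2_inner M f (\<psi> i) * \<psi> i x)))\<^sup>2 \<le>
    (L2_norm M f)\<^sup>2 - (\<Sum>i\<in>F. (cmod (L2_inner M f (\<psi> i)))\<^sup>2)"
proof -
  define c where "c = (\<lambda>i. L2_inner M f (\<psi> i))"
  have "L2_inner M f (\<lambda>x. \<Sum>i\<in>F. c i * \<psi> i x) = (\<Sum>i\<in>F. cnj (c i) * c i)"
    unfolding c_def using psi f by (rule L2_inner_lincomb_right)
  also have "\<dots> = complex_of_real (\<Sum>i\<in>F. (cmod (c i))\<^sup>2)"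
    unfolding of_real_sum by (intro sum.cong) (simp_all only: complex_norm_square mult.commute)
  finally have "Re (L2_inner M f (\<lambda>x. \<Sum>i\<in>F. c i * \<psi> i x)) = (\<Sum>i\<in>F. (cmod (c i))\<^sup>2)"
    by simp
  moreover have "(L2_norm M (\<lambda>x. \<Sum>i\<in>F. c i * \<psi> i x))\<^sup>2 \<le> (\<Sum>i\<in>F. (cmod (c i))\<^sup>2)"
    using assms by (intro frame_synthesis_bound)
  ultimately have "(L2_norm M (\<lambda>x. f x - (\<Sum>i\<in>F. c i * \<psi> i x)))\<^sup>2 \<le>
      (L2_norm M f)\<^sup>2 - (\<Sum>i\<in>F. (cmod (c i))\<^sup>2)"
    using psi f by (subst L2_norm_diff_power2) (auto intro!: L2_lincomb)
  then show ?thesis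
    by (simp add: c_def)
qed

section \<open>Polynomial functions\<close>

lemma finite_multi_idx: "finite (multi_idx n :: ('d::finite \<Rightarrow> nat) set)"
proof (rule finite_subset)
  show "multi_idx n \<subseteq> (\<Pi>\<^sub>E i\<in>(UNIV :: 'd set). {..n})"
  proof
    fix k :: "'d \<Rightarrow> nat" assume k: "k \<in> multi_idx n"
    have "k i \<le> n" for i
      using member_le_sum[of i UNIV k] k by (simp add: multi_idx_def)
    then show "k \<in> (\<Pi>\<^sub>E i\<in>UNIV. {..n})"
      by (simp add: PiE_UNIV_domain)
  qed
qed (simp add: finite_PiE)

lemma monomial_mult: "monomial k x * monomial l x = monomial (\<lambda>i. k i + l i) x"
  by (simp add: monomial_def power_add prod.distrib)

lemma cnj_monomial: "cnj (monomial k x) = monomial k x"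
  by (simp add: monomial_def)

lemma polysE:
  assumes "p \<in> polys n"
  obtains c where "p = (\<lambda>x. \<Sum>k\<in>multi_idx n. c k * monomial k x)"
  using assms by (auto simp: polys_def)

lemma polys_monomial:
  assumes "k \<in> multi_idx n"
  shows "monomial k \<in> polys n"
proof -
  have "monomial k = (\<lambda>x. \<Sum>l\<in>multi_idx n. (if l = k then 1 else 0) * monomial l x)"
  proof
    fix x :: "real ^ 'a"
    have "(\<Sum>l\<in>multi_idx n. (if l = k then 1 else 0) * monomial l x) =
        (\<Sum>l\<in>multi_idx n. if k = l then monomial l x else 0)"
      by (rule sum.cong) auto
    then show "monomial k x = (\<Sum>l\<in>multi_idx n. (if l = k then 1 else 0) * monomial l x)"
      using assms by (simp add: finite_multi_idx)
  qed
  then show ?thesis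
    unfolding polys_def by (intro CollectI exI)
qed

lemma polys_add: "p \<in> polys n \<Longrightarrow> q \<in> polys n \<Longrightarrow> (\<lambda>x. p x + q x) \<in> polys n"
proof -
  assume "p \<in> polys n" "q \<in> polys n"
  then obtain c d where cd: "p = (\<lambda>x. \<Sum>k\<in>multi_idx n. c k * monomial k x)"
    "q = (\<lambda>x. \<Sum>k\<in>multi_idx n. d k * monomial k x)"
    by (elim polysE)
  then have "(\<lambda>x. p x + q x) = (\<lambda>x. \<Sum>k\<in>multi_idx n. (c k + d k) * monomial k x)"
    by (simp only: sum.distrib distrib_right)
  then show ?thesis
    unfolding polys_def by (intro CollectI exI)
qed

lemma polys_cmult: "p \<in> polys n \<Longrightarrow> (\<lambda>x. a * p x) \<in> polys n"
proof -
  assume "p \<in> polys n"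
  then obtain c where "p = (\<lambda>x. \<Sum>k\<in>multi_idx n. c k * monomial k x)"
    by (elim polysE)
  then have "(\<lambda>x. a * p x) = (\<lambda>x. \<Sum>k\<in>multi_idx n. (a * c k) * monomial k x)"
    by (simp only: sum_distrib_left mult.assoc)
  then show ?thesis
    unfolding polys_def by (intro CollectI exI)
qed

lemma polys_zero: "(\<lambda>x. 0) \<in> polys n"
  unfolding polys_def by (intro CollectI exI[of _ "\<lambda>k. 0"]) simp

lemma polys_diff: "p \<in> polys n \<Longrightarrow> q \<in> polys n \<Longrightarrow> (\<lambda>x. p x - q x) \<in> polys n"
  using polys_add[of p n "\<lambda>x. - 1 * q x"] polys_cmult[of q n "-1"] by simp

lemma polys_sum: "(\<And>i. i \<in> I \<Longrightarrow> p i \<in> polys n) \<Longrightarrow> (\<lambda>x. \<Sum>i\<in>I. p i x) \<in> polys n"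
  by (induction I rule: infinite_finite_induct) (auto intro: polys_zero polys_add)

lemma polys_lincomb: "(\<And>i. i \<in> I \<Longrightarrow> p i \<in> polys n) \<Longrightarrow> (\<lambda>x. \<Sum>i\<in>I. c i * p i x) \<in> polys n"
  by (intro polys_sum polys_cmult)

lemma polys_mono: "p \<in> polys m \<Longrightarrow> m \<le> n \<Longrightarrow> p \<in> polys n"
  by (elim polysE, hypsubst, rule polys_lincomb, rule polys_monomial) (auto simp: multi_idx_def)

lemma polys_mult:
  assumes "p \<in> polys m" "q \<in> polys n"
  shows "(\<lambda>x. p x * q x) \<in> polys (m + n)"
proof -
  obtain c d where cd: "p = (\<lambda>x. \<Sum>k\<in>multi_idx m. c k * monomial k x)"
    "q = (\<lambda>x. \<Sum>l\<in>multi_idx n. d l * monomial l x)"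
    using assms by (elim polysE)
  have "(\<lambda>x. p x * q x) =
      (\<lambda>x. \<Sum>k\<in>multi_idx m. \<Sum>l\<in>multi_idx n. (c k * d l) * monomial (\<lambda>i. k i + l i) x)"
    by (simp add: cd sum_product monomial_mult[symmetric] ac_simps)
  also have "\<dots> \<in> polys (m + n)"
    by (intro polys_sum polys_cmult polys_monomial) (auto simp: multi_idx_def sum.distrib)
  finally show ?thesis .
qed

lemma polys_cnj:
  assumes "p \<in> polys n"
  shows "(\<lambda>x. cnj (p x)) \<in> polys n"
proof -
  obtain c where "p = (\<lambda>x. \<Sum>k\<in>multi_idx n. c k * monomial k x)"
    using assms by (rule polysE)
  then have "(\<lambda>x. cnj (p x)) = (\<lambda>x. \<Sum>k\<in>multi_idx n. cnj (c k) * monomial k x)"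
    by (simp only: cnj_sum complex_cnj_mult cnj_monomial)
  then show ?thesis
    unfolding polys_def by (intro CollectI exI)
qed

lemma polys_const: "(\<lambda>x. c) \<in> polys n"
  using polys_cmult[OF polys_monomial[of "\<lambda>i. 0" n], of c] by (simp add: multi_idx_def monomial_def)

lemma polys_0_const:
  assumes "p \<in> polys 0"
  shows "p x = p y"
proof -
  have "multi_idx 0 = {\<lambda>i::'a. 0::nat}"
    by (auto simp: multi_idx_def)
  then show ?thesis
    using assms by (auto simp: polys_def monomial_def)
qed

lemma polys_component: "(\<lambda>x. complex_of_real (x $ i)) \<in> polys 1"
proof -
  have "monomial (\<lambda>j. if j = i then 1 else 0) x = complex_of_real (x $ i)" for x
  proof -
    have "monomial (\<lambda>j. if j = i then 1 else 0) x = (\<Prod>j\<in>UNIV. if j = i then complex_of_real (x $ j) else 1)"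
      unfolding monomial_def by (rule prod.cong) auto
    then show ?thesis by simp
  qed
  moreover have "(\<lambda>j. if j = i then 1 else 0) \<in> multi_idx 1"
    by (simp add: multi_idx_def)
  ultimately show ?thesis
    using polys_monomial[of "\<lambda>j. if j = i then 1 else 0" 1] by presburger
qed

lemma continuous_on_polys: "p \<in> polys n \<Longrightarrow> continuous_on S p"
  by (elim polysE) (auto simp: monomial_def intro!: continuous_intros)

text \<open>Bridge from the inductive notion used by the Stone-Weierstrass theorem to coefficient
  sums. A linear map is expanded in the standard basis; sums and products are brought to degree
  \<open>m + n\<close>.\<close>

lemma real_polynomial_function_polys:
  fixes g :: "real ^ 'd \<Rightarrow> real"
  assumes "real_polynomial_function g"
  shows "\<exists>n. (\<lambda>x. complex_of_real (g x)) \<in> polys n"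
  using assms
proof induction
  case (linear f)
  have "f x = (\<Sum>i\<in>UNIV. f (axis i 1) * x $ i)" for x
  proof -
    interpret bounded_linear f by fact
    have "f x = f (\<Sum>i\<in>UNIV. x $ i *\<^sub>R axis i 1)"
      using basis_expansion[of x] by (simp add: scalar_mult_eq_scaleR)
    then show ?thesis
      by (simp add: sum scaleR mult.commute)
  qed
  then have "f = (\<lambda>x. \<Sum>i\<in>UNIV. f (axis i 1) * x $ i)"
    by (rule ext)
  from arg_cong[OF this, of "\<lambda>h x. complex_of_real (h x)"]
  have "(\<lambda>x. complex_of_real (f x)) =
      (\<lambda>x. \<Sum>i\<in>UNIV. complex_of_real (f (axis i 1)) * complex_of_real (x $ i))"
    by (simp only: of_real_sum of_real_mult)
  also have "\<dots> \<in> polys 1"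
    by (intro polys_lincomb polys_component)
  finally show ?case by blast
next
  case (const c)
  then show ?case by (blast intro: polys_const)
next
  case (add f g)
  then obtain m n where "(\<lambda>x. complex_of_real (f x)) \<in> polys m" "(\<lambda>x. complex_of_real (g x)) \<in> polys n"
    by blast
  then have "(\<lambda>x. complex_of_real (f x) + complex_of_real (g x)) \<in> polys (m + n)"
    by (intro polys_add) (auto elim: polys_mono)
  then show ?case by auto
next
  case (mult f g)
  then obtain m n where "(\<lambda>x. complex_of_real (f x)) \<in> polys m" "(\<lambda>x. complex_of_real (g x)) \<in> polys n"
    by blast
  from polys_mult[OF this] show ?case by auto
qed

text \<open>The real theorem is applied to the real and the imaginary part, each to within
  \<open>e / 2\<close>.\<close>

lemma Stone_Weierstrass_polys:
  fixes f :: "real ^ 'd \<Rightarrow> complex"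
  assumes "compact S" "continuous_on S f" "0 < e"
  obtains n p where "p \<in> polys n" "\<And>x. x \<in> S \<Longrightarrow> cmod (f x - p x) < e"
proof -
  obtain g where g: "real_polynomial_function g" "\<And>x. x \<in> S \<Longrightarrow> \<bar>Re (f x) - g x\<bar> < e / 2"
    using Stone_Weierstrass_real_polynomial_function[OF assms(1), of "\<lambda>x. Re (f x)" "e / 2"]
      assms by (auto intro: continuous_intros)
  obtain h where h: "real_polynomial_function h" "\<And>x. x \<in> S \<Longrightarrow> \<bar>Im (f x) - h x\<bar> < e / 2"
    using Stone_Weierstrass_real_polynomial_function[OF assms(1), of "\<lambda>x. Im (f x)" "e / 2"]
      assms by (auto intro: continuous_intros)
  obtain m n where mn: "(\<lambda>x. complex_of_real (g x)) \<in> polys m" "(\<lambda>x. complex_of_real (h x)) \<in> polys n"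
    using real_polynomial_function_polys[OF g(1)] real_polynomial_function_polys[OF h(1)] by metis
  show ?thesis
  proof
    show "(\<lambda>x. complex_of_real (g x) + \<i> * complex_of_real (h x)) \<in> polys (m + n)"
      using mn by (intro polys_add polys_cmult) (auto elim: polys_mono)
    fix x assume "x \<in> S"
    then show "cmod (f x - (complex_of_real (g x) + \<i> * complex_of_real (h x))) < e"
      using cmod_le[of "f x - (complex_of_real (g x) + \<i> * complex_of_real (h x))"] g(2)[of x] h(2)[of x]
      by auto
  qed
qed


section \<open>The weighted space on the ball\<close>

lemma sets_weighted: "sets (weighted \<mu>) = sets (lebesgue_on unit_ball)"
  by (simp add: weighted_def)

lemma space_weighted: "space (weighted \<mu> :: (real ^ 'd) measure) = unit_ball"
  by (simp add: weighted_def space_restrict_space)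

lemma measurable_weighted_cong: "borel_measurable (weighted \<mu>) = borel_measurable (lebesgue_on unit_ball)"
  by (intro measurable_cong_sets sets_weighted refl)

lemma weight_measurable: "weight \<mu> \<in> borel_measurable (lebesgue_on unit_ball)"
proof -
  have "(\<lambda>x :: real ^ 'd. (1 - (norm x)\<^sup>2) powr (\<mu> - 1/2)) \<in> borel_measurable borel"
    by measurable
  then show ?thesis
    unfolding weight_def by (intro measurable_restrict_space1 measurable_completion) simp
qed

lemma ennreal_weight_measurable:
  "(\<lambda>x. ennreal (weight \<mu> x)) \<in> borel_measurable (lebesgue_on unit_ball)"
  using weight_measurable by measurable

lemma weight_nonneg: "0 \<le> weight \<mu> x"
  by (simp add: weight_def)

lemma continuous_measurable_weighted:
  fixes f :: "real ^ 'd \<Rightarrow> complex"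
  assumes "continuous_on unit_ball f"
  shows "f \<in> borel_measurable (weighted \<mu>)"
  unfolding measurable_weighted_cong using assms
  by (rule continuous_imp_measurable_on_sets_lebesgue) simp

lemma L2_bounded:
  assumes "finite_measure M" "f \<in> borel_measurable M" "\<And>x. x \<in> space M \<Longrightarrow> cmod (f x) \<le> B"
  shows "f \<in> L2 M"
proof -
  have "integrable M (\<lambda>x. (cmod (f x))\<^sup>2)"
  proof (rule finite_measure.integrable_const_bound[OF assms(1)])
    show "AE x in M. norm ((cmod (f x))\<^sup>2) \<le> B\<^sup>2"
      using assms(3) by (intro AE_I2) (simp add: power_mono)
  qed (use assms(2) in measurable)
  then show ?thesis
    using assms(2) by (simp add: L2_def)
qed

lemma L2_continuous:
  fixes f :: "real ^ 'd \<Rightarrow> complex"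
  assumes "finite_measure (weighted \<mu> :: (real ^ 'd) measure)" "continuous_on unit_ball f"
  shows "f \<in> L2 (weighted \<mu>)"
proof -
  have "bounded (f ` unit_ball)"
    using assms(2) by (intro compact_imp_bounded compact_continuous_image) auto
  then obtain B where "\<forall>x\<in>unit_ball. cmod (f x) \<le> B"
    unfolding bounded_iff by blast
  then show ?thesis
    using assms by (intro L2_bounded[where B = B]) (auto simp: space_weighted intro: continuous_measurable_weighted)
qed

lemma L2_polys:
  assumes "finite_measure (weighted \<mu> :: (real ^ 'd) measure)" "p \<in> polys n"
  shows "p \<in> L2 (weighted \<mu> :: (real ^ 'd) measure)"
  using assms by (intro L2_continuous continuous_on_polys)

text \<open>In the open ball the weight is positive whatever the exponent, so sets null for the
  weighted measure are Lebesgue null there. The sphere is left out because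
  \<open>0 powr a = 0\<close> makes the weight vanish on it.\<close>

lemma AE_weightedD:
  assumes "AE x in (weighted \<mu> :: (real ^ 'd) measure). P x"
  shows "AE x in lebesgue. x \<in> ball 0 1 \<longrightarrow> P x"
proof -
  have "AE x in lebesgue_on (unit_ball :: (real ^ 'd) set). 0 < ennreal (weight \<mu> x) \<longrightarrow> P x"
    using assms unfolding weighted_def by (subst (asm) AE_density) (rule ennreal_weight_measurable, simp)
  then have "AE x in lebesgue. x \<in> unit_ball \<longrightarrow> (0 < ennreal (weight \<mu> x) \<longrightarrow> P x)"
    by (subst (asm) AE_restrict_space_iff) auto
  then show ?thesis
  proof (elim AE_mp, intro AE_I2 impI)
    fix x :: "real ^ 'd"
    assume *: "x \<in> unit_ball \<longrightarrow> (0 < ennreal (weight \<mu> x) \<longrightarrow> P x)" and x: "x \<in> ball 0 1"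
    have "(norm x)\<^sup>2 < 1"
      using x by (simp add: power_less_one_iff)
    then have "0 < weight \<mu> x"
      by (simp add: weight_def)
    then show "P x"
      using * x by auto
  qed
qed

text \<open>The points of the open ball where \<open>p\<close> is nonzero form an open null set,
  hence the empty set, and continuity reaches the sphere. This upgrades identities almost everywhere
  to pointwise ones, as evaluation at cubature points requires.\<close>

lemma continuous_AE_zero:
  fixes p :: "real ^ 'd \<Rightarrow> complex"
  assumes cont: "continuous_on UNIV p" and AE: "AE x in weighted \<mu>. p x = 0" and x: "x \<in> unit_ball"
  shows "p x = 0"
proof -
  define U where "U = {x. p x \<noteq> 0} \<inter> ball 0 1"
  have "open U"
    unfolding U_def using cont by (intro open_Int open_Collect_neq) (auto intro: continuous_intros)
  moreover have "AE x in lebesgue. x \<notin> U"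
    using AE_weightedD[OF AE] by (rule AE_mp) (auto simp: U_def)
  then have "negligible U"
    using \<open>open U\<close> by (simp add: negligible_iff_null_sets AE_iff_null_sets borel_open)
  ultimately have "U = {}"
    using open_not_negligible by blast
  then have "ball 0 1 \<subseteq> {x. p x = 0}"
    by (auto simp: U_def)
  moreover have "closed {x. p x = 0}"
    using cont by (intro closed_Collect_eq) (auto intro: continuous_intros)
  ultimately have "closure (ball 0 1) \<subseteq> {x. p x = 0}"
    by (rule closure_minimal)
  then show ?thesis
    using x by (auto simp: closure_ball)
qed

section \<open>Density of the polynomials in the weighted space\<close>

lemma L2_truncate:
  assumes "f \<in> L2 M"
  shows "(\<lambda>n. L2_norm M (\<lambda>x. f x - (if cmod (f x) \<le> real n then f x else 0))) \<longlonglongrightarrow> 0"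
proof -
  have [measurable]: "f \<in> borel_measurable M" and int: "integrable M (\<lambda>x. (cmod (f x))\<^sup>2)"
    using assms by (auto simp: L2_def)
  let ?d = "\<lambda>n x. (cmod (f x - (if cmod (f x) \<le> real n then f x else 0)))\<^sup>2"
  have "(\<lambda>n. LINT x|M. ?d n x) \<longlonglongrightarrow> (LINT x|M. 0)"
  proof (rule integral_dominated_convergence[OF _ _ int])
    show "AE x in M. (\<lambda>n. ?d n x) \<longlonglongrightarrow> 0"
    proof (rule AE_I2)
      fix x
      obtain N where N: "cmod (f x) \<le> real N"
        using real_arch_simple by blast
      have "eventually (\<lambda>n. ?d n x = 0) sequentially"
        using eventually_ge_at_top[of N] by (rule eventually_mono) (use N in auto)
      then show "(\<lambda>n. ?d n x) \<longlonglongrightarrow> 0"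
        by (rule tendsto_eventually)
    qed
  qed (auto intro!: AE_I2)
  then show ?thesis
    using tendsto_real_sqrt by (fastforce simp: L2_norm_def)
qed

text \<open>\<open>measurable_on\<close> supplies continuous functions that converge to
  \<open>f\<close> off a negligible set, but without a common bound. Composition with the nearest
  point map onto the disc of radius \<open>B\<close> keeps continuity and the limit and provides the
  majorant \<open>(2 * B)\<^sup>2\<close>.\<close>

lemma continuous_dense_bounded:
  fixes f :: "real ^ 'd \<Rightarrow> complex"
  assumes fin: "finite_measure (weighted \<mu> :: (real ^ 'd) measure)"
    and f: "f \<in> borel_measurable (weighted \<mu>)" and B: "\<And>x. cmod (f x) \<le> B"
  shows "\<exists>g. (\<forall>n. continuous_on UNIV (g n)) \<and>
    (\<lambda>n. L2_norm (weighted \<mu>) (\<lambda>x. f x - g n x)) \<longlonglongrightarrow> 0"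
proof -
  have "0 \<le> B"
    using B[of 0] norm_ge_zero order_trans by blast
  have "f measurable_on unit_ball"
    using f unfolding measurable_weighted_cong by (subst measurable_on_iff_borel_measurable) auto
  then obtain N g where N: "negligible N" and g: "\<And>n. continuous_on UNIV (g n)"
    and lim: "\<And>x. x \<notin> N \<Longrightarrow> (\<lambda>n. g n x) \<longlonglongrightarrow> (if x \<in> unit_ball then f x else 0)"
    unfolding measurable_on_def by auto
  define c where "c = (\<lambda>z. closest_point (cball 0 B) (z :: complex))"
  have cont_c: "continuous_on UNIV c"
    unfolding c_def using \<open>0 \<le> B\<close> by (intro continuous_on_closest_point) auto
  have c_bound: "cmod (c z) \<le> B" for z
    using closest_point_in_set[of "cball 0 B" z] \<open>0 \<le> B\<close> by (auto simp: c_def)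
  have c_id: "c (f x) = f x" for x
    unfolding c_def using B[of x] by (intro closest_point_self) auto
  define h where "h = (\<lambda>n x. c (g n x))"
  have h: "continuous_on UNIV (h n)" for n
    unfolding h_def using continuous_on_compose2[OF cont_c g[of n]] by simp
  have h_meas [measurable]: "h n \<in> borel_measurable (weighted \<mu>)" for n
    using h by (intro continuous_measurable_weighted) (blast intro: continuous_on_subset)
  note f [measurable]
  have "AE x in lebesgue_on (unit_ball :: (real ^ 'd) set). x \<notin> N"
    using N by (subst AE_restrict_space_iff)
      (auto simp: negligible_iff_null_sets intro: AE_mp[OF AE_not_in])
  then have "AE x in lebesgue_on unit_ball. 0 < ennreal (weight \<mu> x) \<longrightarrow> x \<notin> N"
    by (rule AE_mp) simp
  then have "AE x in weighted \<mu>. x \<notin> N"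
    unfolding weighted_def by (subst AE_density[OF ennreal_weight_measurable])
  have "(\<lambda>n. LINT x|weighted \<mu>. (cmod (f x - h n x))\<^sup>2) \<longlonglongrightarrow> (LINT x|(weighted \<mu> :: (real ^ 'd) measure). (0 :: real))"
  proof (rule integral_dominated_convergence[where w = "\<lambda>x. (2 * B)\<^sup>2"])
    show "integrable (weighted \<mu> :: (real ^ 'd) measure) (\<lambda>x. (2 * B)\<^sup>2)"
      using fin finite_measure.integrable_const by blast
    show "AE x in weighted \<mu>. (\<lambda>n. (cmod (f x - h n x))\<^sup>2) \<longlonglongrightarrow> 0"
      using \<open>AE x in weighted \<mu>. x \<notin> N\<close>
    proof (rule AE_mp, intro AE_I2 impI)
      fix x :: "real ^ 'd"
      assume "x \<in> space (weighted \<mu>)" "x \<notin> N"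
      then have "(\<lambda>n. g n x) \<longlonglongrightarrow> f x"
        using lim[of x] by (simp add: space_weighted)
      then have "(\<lambda>n. h n x) \<longlonglongrightarrow> c (f x)"
        unfolding h_def using cont_c continuous_on_tendsto_compose[OF cont_c] by auto
      then have "(\<lambda>n. (cmod (f x - h n x))\<^sup>2) \<longlonglongrightarrow> (cmod (f x - c (f x)))\<^sup>2"
        by (intro tendsto_intros)
      then show "(\<lambda>n. (cmod (f x - h n x))\<^sup>2) \<longlonglongrightarrow> 0"
        by (simp add: c_id)
    qed
    show "AE x in weighted \<mu>. norm ((cmod (f x - h n x))\<^sup>2) \<le> (2 * B)\<^sup>2" for n
    proof (rule AE_I2)
      fix x
      have "cmod (f x - h n x) \<le> 2 * B"
        using norm_triangle_ineq4[of "f x" "h n x"] B[of x] c_bound[of "g n x"] by (simp add: h_def)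
      then show "norm ((cmod (f x - h n x))\<^sup>2) \<le> (2 * B)\<^sup>2"
        using power_mono[of "cmod (f x - h n x)" "2 * B" 2] by simp
    qed
  qed measurable
  then have "(\<lambda>n. L2_norm (weighted \<mu>) (\<lambda>x. f x - h n x)) \<longlonglongrightarrow> 0"
    using tendsto_real_sqrt by (fastforce simp: L2_norm_def)
  then show ?thesis
    using h by blast
qed

lemma tendsto_zero_power2_less:
  fixes a :: "nat \<Rightarrow> real"
  assumes "a \<longlonglongrightarrow> 0" "0 < \<delta>"
  shows "\<exists>n. (a n)\<^sup>2 < \<delta>"
proof -
  have "(\<lambda>n. (a n)\<^sup>2) \<longlonglongrightarrow> 0\<^sup>2"
    by (intro tendsto_power assms)
  then have "eventually (\<lambda>n. (a n)\<^sup>2 < \<delta>) sequentially"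
    using assms(2) by (intro order_tendstoD(2)) auto
  then show ?thesis
    by (rule eventually_happens'[OF sequentially_bot])
qed

text \<open>Three approximations in a row: truncation, a continuous function, and a polynomial
  uniformly close on the compact ball. Finiteness of the measure turns the uniform error into an
  error in norm.\<close>

lemma polys_dense:
  fixes f :: "real ^ 'd \<Rightarrow> complex"
  assumes fin: "finite_measure (weighted \<mu> :: (real ^ 'd) measure)"
    and f: "f \<in> L2 (weighted \<mu>)" and "0 < \<epsilon>"
  shows "\<exists>n. \<exists>p\<in>polys n. (L2_norm (weighted \<mu>) (\<lambda>x. f x - p x))\<^sup>2 < \<epsilon>"
proof -
  let ?M = "weighted \<mu> :: (real ^ 'd) measure"
  interpret finite_measure ?M by fact
  have f_meas [measurable]: "f \<in> borel_measurable ?M"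
    using f by (simp add: L2_def)
  \<comment> \<open>Error budget for the squared norms: two steps below
    \<open>\<epsilon> / 16\<close> combine to less than \<open>\<epsilon> / 4\<close>, and together
    with \<open>\<epsilon> / 8\<close> to less than \<open>3 * \<epsilon> / 4\<close>, since each
    use of the triangle inequality doubles.\<close>
  obtain N where N: "(L2_norm ?M (\<lambda>x. f x - (if cmod (f x) \<le> real N then f x else 0)))\<^sup>2 < \<epsilon> / 8"
    using tendsto_zero_power2_less[OF L2_truncate[OF f], of "\<epsilon> / 8"] \<open>0 < \<epsilon>\<close> by auto
  define u where "u = (\<lambda>x. if cmod (f x) \<le> real N then f x else 0)"
  have u_meas: "u \<in> borel_measurable ?M"
    unfolding u_def by measurable
  have u_bound: "cmod (u x) \<le> real N" for x
    by (simp add: u_def)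
  have u: "u \<in> L2 ?M"
    using u_meas u_bound by (intro L2_bounded fin)
  obtain g where g: "\<And>n. continuous_on UNIV (g n)"
    "(\<lambda>n. L2_norm ?M (\<lambda>x. u x - g n x)) \<longlonglongrightarrow> 0"
    using continuous_dense_bounded[OF fin u_meas u_bound] by blast
  obtain K where K: "(L2_norm ?M (\<lambda>x. u x - g K x))\<^sup>2 < \<epsilon> / 16"
    using tendsto_zero_power2_less[OF g(2), of "\<epsilon> / 16"] \<open>0 < \<epsilon>\<close> by auto
  have gc: "continuous_on unit_ball (g K)"
    using g(1) continuous_on_subset by blast
  have gL: "g K \<in> L2 ?M"
    by (rule L2_continuous[OF fin gc])
  \<comment> \<open>Chosen so that \<open>e\<^sup>2\<close> times the total mass stays below
    \<open>\<epsilon> / 16\<close>; the added 1 keeps the divisor positive and the bound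
    strict.\<close>
  define e where "e = sqrt (\<epsilon> / (16 * (measure ?M (space ?M) + 1)))"
  have e: "0 < e" "e\<^sup>2 * measure ?M (space ?M) < \<epsilon> / 16"
  proof -
    have m: "0 \<le> measure ?M (space ?M)" by simp
    then show e0: "0 < e"
      using \<open>0 < \<epsilon>\<close> unfolding e_def
      by (intro real_sqrt_gt_zero divide_pos_pos mult_pos_pos add_nonneg_pos) auto
    have "e\<^sup>2 = \<epsilon> / (16 * (measure ?M (space ?M) + 1))"
      using \<open>0 < \<epsilon>\<close> m unfolding e_def by (intro real_sqrt_pow2) simp
    then have "e\<^sup>2 * (measure ?M (space ?M) + 1) = \<epsilon> / 16"
      using m by (simp add: field_simps)
    then show "e\<^sup>2 * measure ?M (space ?M) < \<epsilon> / 16"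
      using zero_less_power[OF e0, of 2] unfolding distrib_left by linarith
  qed
  obtain n p where p: "p \<in> polys n" "\<And>x. x \<in> unit_ball \<Longrightarrow> cmod (g K x - p x) < e"
    using Stone_Weierstrass_polys[OF compact_cball gc e(1)] by blast
  have pL: "p \<in> L2 ?M"
    by (rule L2_polys[OF fin p(1)])
  have "(L2_norm ?M (\<lambda>x. g K x - p x))\<^sup>2 \<le> (LINT x|?M. e\<^sup>2)"
    unfolding L2_norm_power2
  proof (rule integral_mono)
    show "integrable ?M (\<lambda>x. (cmod (g K x - p x))\<^sup>2)"
      using L2_diff[OF gL pL] by (simp add: L2_def)
    fix x assume "x \<in> space ?M"
    then have "cmod (g K x - p x) \<le> e"
      using p(2)[of x] by (simp add: space_weighted)
    then show "(cmod (g K x - p x))\<^sup>2 \<le> e\<^sup>2"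
      by (simp add: power_mono)
  qed simp
  then have gp: "(L2_norm ?M (\<lambda>x. g K x - p x))\<^sup>2 < \<epsilon> / 16"
    using e(2) by (simp add: mult.commute)
  have "(L2_norm ?M (\<lambda>x. (u x - g K x) + (g K x - p x)))\<^sup>2 < \<epsilon> / 4"
    using L2_norm_triangle_power2[OF L2_diff[OF u gL] L2_diff[OF gL pL]] K gp by simp
  moreover have "(L2_norm ?M (\<lambda>x. (f x - u x) + (u x - p x)))\<^sup>2 \<le>
      2 * (L2_norm ?M (\<lambda>x. f x - u x))\<^sup>2 + 2 * (L2_norm ?M (\<lambda>x. u x - p x))\<^sup>2"
    by (intro L2_norm_triangle_power2 L2_diff f u pL)
  ultimately have "(L2_norm ?M (\<lambda>x. f x - p x))\<^sup>2 < \<epsilon>"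
    using N \<open>0 < \<epsilon>\<close> by (simp add: u_def)
  then show ?thesis
    using p(1) by blast
qed

section \<open>Orthogonal polynomials and their kernels\<close>

text \<open>\<open>gram_schmidt\<close> takes a set of functions as generators, so the sum over
  exponents is regrouped over the image, adding up the coefficients of exponents that give the same
  function.\<close>

lemma polys_eq_lincomb_monomials:
  assumes "p \<in> polys n"
  obtains c where "p = (\<lambda>x. \<Sum>g\<in>monomial ` multi_idx n. c g * g x)"
proof -
  obtain c where c: "p = (\<lambda>x. \<Sum>k\<in>multi_idx n. c k * monomial k x)"
    using assms by (rule polysE)
  have "p x = (\<Sum>g\<in>monomial ` multi_idx n. (\<Sum>k\<in>{k \<in> multi_idx n. monomial k = g}. c k) * g x)" for x
  proof -
    have "p x = (\<Sum>g\<in>monomial ` multi_idx n. \<Sum>k\<in>{k \<in> multi_idx n. monomial k = g}. c k * monomial k x)"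
      unfolding c by (rule sum.image_gen[OF finite_multi_idx])
    also have "\<dots> = (\<Sum>g\<in>monomial ` multi_idx n. (\<Sum>k\<in>{k \<in> multi_idx n. monomial k = g}. c k) * g x)"
      unfolding sum_distrib_right by (intro sum.cong) auto
    finally show ?thesis .
  qed
  then show ?thesis
    by (rule that[OF ext])
qed

lemma orth_polys_add: "finite_measure (weighted \<mu> :: (real ^ 'd) measure) \<Longrightarrow>
    p \<in> orth_polys \<mu> n \<Longrightarrow> q \<in> orth_polys \<mu> n \<Longrightarrow>
    (\<lambda>x :: real ^ 'd. p x + q x) \<in> orth_polys \<mu> n"
  by (auto simp: orth_polys_def L2_inner_add_left L2_polys intro: polys_add)

lemma orth_polys_cmult: "p \<in> orth_polys \<mu> n \<Longrightarrow> (\<lambda>x. c * p x) \<in> orth_polys \<mu> n"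
  by (auto simp: orth_polys_def L2_inner_cmult_left intro: polys_cmult)

lemma orth_polys_diff: "finite_measure (weighted \<mu> :: (real ^ 'd) measure) \<Longrightarrow>
    p \<in> orth_polys \<mu> n \<Longrightarrow> q \<in> orth_polys \<mu> n \<Longrightarrow>
    (\<lambda>x :: real ^ 'd. p x - q x) \<in> orth_polys \<mu> n"
  by (auto simp: orth_polys_def L2_inner_diff_left L2_polys intro: polys_diff)

lemma orth_polys_lincomb:
  fixes e :: "'i \<Rightarrow> real ^ 'd \<Rightarrow> complex"
  assumes "finite_measure (weighted \<mu> :: (real ^ 'd) measure)" "\<And>i. i \<in> I \<Longrightarrow> e i \<in> orth_polys \<mu> n"
  shows "(\<lambda>x. \<Sum>i\<in>I. c i * e i x) \<in> orth_polys \<mu> n"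
  using assms(2)
proof (induction I rule: infinite_finite_induct)
  case (insert i I)
  then show ?case
    using orth_polys_add[OF assms(1) orth_polys_cmult, of "e i" n "\<lambda>x. \<Sum>i\<in>I. c i * e i x" "c i"] by simp
qed (auto simp: orth_polys_def L2_inner_def polys_zero)

lemma orth_polys_polys: "p \<in> orth_polys \<mu> n \<Longrightarrow> p \<in> polys n"
  by (simp add: orth_polys_def)

text \<open>
  The last condition says that expanding a polynomial of degree at most \<open>n\<close> in \<open>E\<close> leaves a
  polynomial of lower degree; in degree zero nothing is left.
\<close>

definition orth_basis :: "real \<Rightarrow> nat \<Rightarrow> (real ^ 'd \<Rightarrow> complex) set \<Rightarrow> bool" where
  "orth_basis \<mu> n E \<longleftrightarrow> E \<subseteq> orth_polys \<mu> n \<and> orthonormal_on (weighted \<mu>) E (\<lambda>e. e) \<and>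
    (\<forall>p\<in>polys n. \<exists>q. (q \<in> (if n = 0 then {\<lambda>x. 0} else polys (n - 1))) \<and>
       (AE x in weighted \<mu>. p x - q x = (\<Sum>e\<in>E. L2_inner (weighted \<mu>) p e * e x)))"

text \<open>\<open>q\<close> is the orthogonal projection of \<open>p\<close> onto the polynomials
  of degree at most \<open>n - 1\<close>, written in a Gram-Schmidt basis of that space. Degree zero
  is separate: the orthogonality conditions are empty there, while \<open>n - 1\<close> would again
  be 0.\<close>

lemma orth_decomposition:
  fixes p :: "real ^ 'd \<Rightarrow> complex"
  assumes fin: "finite_measure (weighted \<mu> :: (real ^ 'd) measure)" and p: "p \<in> polys n"
  shows "\<exists>q\<in>(if n = 0 then {\<lambda>x. 0} else polys (n - 1)). (\<lambda>x. p x - q x) \<in> orth_polys \<mu> n"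
proof (cases "n = 0")
  case True
  then show ?thesis
    using p by (simp add: orth_polys_def)
next
  case False
  let ?M = "weighted \<mu> :: (real ^ 'd) measure"
  have "\<exists>F. F \<subseteq> polys (n - 1) \<and> orthonormal_on ?M F (\<lambda>e. e) \<and>
      (\<forall>g\<in>monomial ` multi_idx (n - 1). AE x in ?M. g x = (\<Sum>e\<in>F. L2_inner ?M g e * e x))"
    by (rule gram_schmidt)
      (auto simp: finite_multi_idx intro: polys_add polys_cmult polys_monomial L2_polys[OF fin])
  then obtain F where F: "F \<subseteq> polys (n - 1)" "orthonormal_on ?M F (\<lambda>e. e)"
    "\<forall>g\<in>monomial ` multi_idx (n - 1). AE x in ?M. g x = (\<Sum>e\<in>F. L2_inner ?M g e * e x)"
    by blast
  define q where "q = (\<lambda>x. \<Sum>e\<in>F. L2_inner ?M p e * e x)"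
  have q: "q \<in> polys (n - 1)"
    unfolding q_def using F by (intro polys_lincomb) auto
  have pL: "p \<in> L2 ?M" and qL: "q \<in> L2 ?M"
    using p q L2_polys[OF fin] by auto
  have ortho: "L2_inner ?M (\<lambda>x. p x - q x) e = 0" if "e \<in> F" for e
    using orthonormal_inner_lincomb[OF F(2) that] orthonormal_onD(2)[OF F(2) that] pL qL
    by (simp add: L2_inner_diff_left q_def)
  have "L2_inner ?M (\<lambda>x. p x - q x) r = 0" if "m < n" "r \<in> polys m" for m r
  proof -
    have r: "r \<in> polys (n - 1)"
      using that by (auto elim: polys_mono)
    then obtain c where c: "r = (\<lambda>x. \<Sum>g\<in>monomial ` multi_idx (n - 1). c g * g x)"
      by (rule polys_eq_lincomb_monomials)
    have AE: "AE x in ?M. r x = (\<Sum>e\<in>F. L2_inner ?M r e * e x)"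
      unfolding c using F by (intro expansion_lincomb)
        (auto simp: finite_multi_idx intro: polys_monomial L2_polys[OF fin])
    have "L2_inner ?M (\<lambda>x. p x - q x) r =
        L2_inner ?M (\<lambda>x. p x - q x) (\<lambda>x. \<Sum>e\<in>F. L2_inner ?M r e * e x)"
      using AE pL qL L2_polys[OF fin r] F
      by (intro L2_inner_cong_AE L2_diff L2_lincomb) (auto dest: orthonormal_onD(2))
    also have "\<dots> = 0"
      using pL qL F(2) by (subst L2_inner_lincomb_right) (auto dest: orthonormal_onD(2) simp: ortho intro: L2_diff)
    finally show ?thesis .
  qed
  then have "(\<lambda>x. p x - q x) \<in> orth_polys \<mu> n"
    using p q by (auto simp: orth_polys_def intro!: polys_diff elim: polys_mono)
  then show ?thesis
    using q False by auto
qed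

lemma orth_polys_inner_lower:
  assumes p: "p \<in> orth_polys \<mu> n" and q: "q \<in> (if n = 0 then {\<lambda>x. 0} else polys (n - 1))"
  shows "L2_inner (weighted \<mu>) q p = 0"
proof (cases "n = 0")
  case True
  then show ?thesis
    using q by (simp add: L2_inner_def)
next
  case False
  then have "n - 1 < n" "q \<in> polys (n - 1)"
    using q by auto
  then have "L2_inner (weighted \<mu>) p q = 0"
    using p unfolding orth_polys_def by blast
  then show ?thesis
    by (subst L2_inner_commute) simp
qed

text \<open>Every monomial of degree at most \<open>n\<close> is freed of its lower degree part by
  \<open>orth_decomposition\<close>, and Gram-Schmidt is run on the remainders inside
  \<open>orth_polys \<mu> n\<close>. Linearity extends the expansion to all polynomials.\<close>

lemma orth_basis_exists:
  assumes fin: "finite_measure (weighted \<mu> :: (real ^ 'd) measure)"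
  shows "\<exists>E :: (real ^ 'd \<Rightarrow> complex) set. orth_basis \<mu> n E"
proof -
  let ?M = "weighted \<mu> :: (real ^ 'd) measure"
  let ?L = "if n = 0 then {\<lambda>x. 0} else polys (n - 1) :: (real ^ 'd \<Rightarrow> complex) set"
  have "\<forall>g\<in>monomial ` multi_idx n. \<exists>q\<in>?L. (\<lambda>x. g x - q x) \<in> orth_polys \<mu> n"
    using orth_decomposition[OF fin] by (blast intro: polys_monomial)
  from bchoice[OF this[unfolded Bex_def]]
  obtain Q where "\<forall>g\<in>monomial ` multi_idx n. Q g \<in> ?L \<and> (\<lambda>x. g x - Q g x) \<in> orth_polys \<mu> n"
    by (elim exE)
  then have Q: "\<And>g. g \<in> monomial ` multi_idx n \<Longrightarrow> Q g \<in> ?L"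
    "\<And>g. g \<in> monomial ` multi_idx n \<Longrightarrow> (\<lambda>x. g x - Q g x) \<in> orth_polys \<mu> n"
    by (simp_all only: Ball_def)
  define r where "r = (\<lambda>g x. g x - Q g x)"
  have "\<exists>E. E \<subseteq> orth_polys \<mu> n \<and> orthonormal_on ?M E (\<lambda>e. e) \<and>
      (\<forall>g\<in>r ` monomial ` multi_idx n. AE x in ?M. g x = (\<Sum>e\<in>E. L2_inner ?M g e * e x))"
  proof (rule gram_schmidt)
    show "orth_polys \<mu> n \<subseteq> L2 ?M"
      using L2_polys[OF fin] orth_polys_polys by blast
    show "finite (r ` monomial ` multi_idx n)"
      by (intro finite_imageI finite_multi_idx)
    show "r ` monomial ` multi_idx n \<subseteq> orth_polys \<mu> n"
      using Q(2) by (auto simp: r_def)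
  qed (fact orth_polys_add[OF fin] orth_polys_cmult)+
  then obtain E where E: "E \<subseteq> orth_polys \<mu> n" "orthonormal_on ?M E (\<lambda>e. e)"
    "\<forall>g\<in>r ` monomial ` multi_idx n. AE x in ?M. g x = (\<Sum>e\<in>E. L2_inner ?M g e * e x)"
    by (elim exE conjE)
  have rE: "AE x in ?M. r g x = (\<Sum>e\<in>E. L2_inner ?M (r g) e * e x)"
    if "g \<in> monomial ` multi_idx n" for g
    using E(3) imageI[OF that] by (rule bspec)
  have "\<exists>q\<in>?L. AE x in ?M. p x - q x = (\<Sum>e\<in>E. L2_inner ?M p e * e x)"
    if p: "p \<in> polys n" for p
  proof -
    obtain c where c: "p = (\<lambda>x. \<Sum>g\<in>monomial ` multi_idx n. c g * g x)"
      using p by (rule polys_eq_lincomb_monomials)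
    define q where "q = (\<lambda>x. \<Sum>g\<in>monomial ` multi_idx n. c g * Q g x)"
    have q: "q \<in> ?L"
    proof (cases "n = 0")
      case True
      then show ?thesis using Q(1) by (simp add: q_def)
    next
      case False
      then show ?thesis using Q(1) by (auto simp: q_def intro!: polys_sum polys_cmult)
    qed
    have pL: "p \<in> L2 ?M" and qL: "q \<in> L2 ?M"
      using p q L2_polys[OF fin] by (auto simp: L2_zero split: if_splits)
    have rL: "r g \<in> L2 ?M" if "g \<in> monomial ` multi_idx n" for g
      using Q(2)[OF that] L2_polys[OF fin] by (auto simp: r_def intro: orth_polys_polys)
    have pq: "(\<lambda>x. p x - q x) = (\<lambda>x. \<Sum>g\<in>monomial ` multi_idx n. c g * r g x)"
      by (simp add: c q_def r_def sum_subtractf right_diff_distrib)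
    \<comment> \<open>The lower degree part \<open>q\<close> is orthogonal to \<open>e\<close>, so
      the coefficients of \<open>p - q\<close> are those of \<open>p\<close> itself.\<close>
    have inner: "(\<Sum>g\<in>monomial ` multi_idx n. c g * L2_inner ?M (r g) e) = L2_inner ?M p e" if "e \<in> E" for e
    proof -
      have eL: "e \<in> L2 ?M"
        using E(2) that by (rule orthonormal_onD(2))
      have "(\<Sum>g\<in>monomial ` multi_idx n. c g * L2_inner ?M (r g) e) = L2_inner ?M (\<lambda>x. p x - q x) e"
        unfolding pq by (rule L2_inner_lincomb_left[symmetric]) (use rL eL in auto)
      also have "\<dots> = L2_inner ?M p e - L2_inner ?M q e"
        by (rule L2_inner_diff_left[OF pL qL eL])
      also have "L2_inner ?M q e = 0"
        using E(1) that q by (intro orth_polys_inner_lower) auto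
      finally show ?thesis by simp
    qed
    have "AE x in ?M. \<forall>g\<in>monomial ` multi_idx n. r g x = (\<Sum>e\<in>E. L2_inner ?M (r g) e * e x)"
      using rE by (intro AE_finite_allI) (auto simp: finite_multi_idx)
    then have "AE x in ?M. p x - q x = (\<Sum>e\<in>E. L2_inner ?M p e * e x)"
    proof (rule AE_mp, intro AE_I2 impI)
      fix x
      assume *: "\<forall>g\<in>monomial ` multi_idx n. r g x = (\<Sum>e\<in>E. L2_inner ?M (r g) e * e x)"
      have "p x - q x = (\<Sum>g\<in>monomial ` multi_idx n. c g * r g x)"
        using pq by meson
      also have "\<dots> = (\<Sum>g\<in>monomial ` multi_idx n. c g * (\<Sum>e\<in>E. L2_inner ?M (r g) e * e x))"
        using * by (intro sum.cong refl arg_cong2[where f = "(*)"]) blast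
      also have "\<dots> = (\<Sum>e\<in>E. (\<Sum>g\<in>monomial ` multi_idx n. c g * L2_inner ?M (r g) e) * e x)"
        unfolding sum_distrib_left sum_distrib_right by (subst sum.swap) (simp only: mult.assoc)
      also have "\<dots> = (\<Sum>e\<in>E. L2_inner ?M p e * e x)"
        by (intro sum.cong refl) (simp only: inner)
      finally show "p x - q x = (\<Sum>e\<in>E. L2_inner ?M p e * e x)" .
    qed
    then show ?thesis
      using q by blast
  qed
  then show ?thesis
    unfolding orth_basis_def Bex_def by (intro exI[of _ E] conjI ballI E) auto
qed

lemma orth_basisD:
  assumes "orth_basis \<mu> n E"
  shows "e \<in> E \<Longrightarrow> e \<in> orth_polys \<mu> n" "e \<in> E \<Longrightarrow> e \<in> polys n"
    "e \<in> E \<Longrightarrow> e \<in> L2 (weighted \<mu>)"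
    "orthonormal_on (weighted \<mu>) E (\<lambda>e. e)" "finite E"
  using assms by (auto simp: orth_basis_def orth_polys_def orthonormal_on_def)

lemma orth_basis_lincomb: "orth_basis \<mu> n E \<Longrightarrow> (\<lambda>x. \<Sum>e\<in>E. c e * e x) \<in> L2 (weighted \<mu>)"
  by (intro L2_lincomb orth_basisD(3))

lemma sum_Sigma_snd:
  assumes "finite A" "\<And>n. n \<in> A \<Longrightarrow> finite (E n)"
  shows "(\<Sum>i\<in>Sigma A E. g (snd i)) = (\<Sum>n\<in>A. \<Sum>e\<in>E n. g e)"
  using assms by (subst sum.Sigma) (auto simp: split_beta)

text \<open>Induction on the degree. Expanding in the top basis leaves some \<open>q\<close> of
  lower degree, and \<open>p - q\<close> lies in the span of \<open>E (Suc n)\<close>, which is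
  orthogonal to all lower bases; hence \<open>p\<close> and \<open>q\<close> have the same lower
  coefficients.\<close>

lemma orth_basis_expansion:
  fixes p :: "real ^ 'd \<Rightarrow> complex"
  assumes fin: "finite_measure (weighted \<mu> :: (real ^ 'd) measure)"
    and E: "\<And>n. orth_basis \<mu> n (E n)"
  shows "p \<in> polys n \<Longrightarrow> AE x in weighted \<mu>. p x =
    (\<Sum>i\<in>Sigma {..n} E. L2_inner (weighted \<mu>) p (snd i) * snd i x)"
proof (induction n arbitrary: p)
  case 0
  then show ?case
    using E[of 0] orth_basisD(5)[OF E[of 0]] 
    by (subst sum_Sigma_snd[where g = "\<lambda>e. L2_inner (weighted \<mu>) p e * e _"])
      (simp_all add: orth_basis_def)
next
  case (Suc n)
  let ?M = "weighted \<mu> :: (real ^ 'd) measure"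
  note fE = orth_basisD(5)[OF E]
  obtain q where q: "q \<in> polys n"
    and pq: "AE x in ?M. p x - q x = (\<Sum>e\<in>E (Suc n). L2_inner ?M p e * e x)"
    using E[of "Suc n"] Suc.prems unfolding orth_basis_def by (metis (no_types) diff_Suc_1 nat.distinct(1))
  have pL: "p \<in> L2 ?M" and qL: "q \<in> L2 ?M"
    using Suc.prems q L2_polys[OF fin] by auto
  have inner: "L2_inner ?M q e = L2_inner ?M p e" if e: "m \<le> n" "e \<in> E m" for m e
  proof -
    have eL: "e \<in> L2 ?M"
      using e orth_basisD(3)[OF E] by blast
    have zero: "L2_inner ?M u e = 0" if "u \<in> E (Suc n)" for u
      using orth_basisD(1)[OF E that] orth_basisD(2)[OF E e(2)] le_imp_less_Suc[OF e(1)]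
      unfolding orth_polys_def by blast
    have "L2_inner ?M p e - L2_inner ?M q e = L2_inner ?M (\<lambda>x. p x - q x) e"
      by (rule L2_inner_diff_left[OF pL qL eL, symmetric])
    also have "\<dots> = L2_inner ?M (\<lambda>x. \<Sum>e\<in>E (Suc n). L2_inner ?M p e * e x) e"
      using pq pL qL eL by (intro L2_inner_cong_AE L2_diff L2_lincomb) (auto intro: orth_basisD(3)[OF E])
    also have "\<dots> = 0"
      using eL by (subst L2_inner_lincomb_left) (auto intro: orth_basisD(3)[OF E] simp: zero)
    finally show ?thesis by simp
  qed
  have "AE x in ?M. q x = (\<Sum>i\<in>Sigma {..n} E. L2_inner ?M q (snd i) * snd i x)"
    using Suc.IH q by blast
  with pq show ?case
  proof (eventually_elim)
    case (elim x)
    have "p x = q x + (\<Sum>e\<in>E (Suc n). L2_inner ?M p e * e x)"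
      using elim(1) by (simp add: algebra_simps)
    also have "q x = (\<Sum>m\<le>n. \<Sum>e\<in>E m. L2_inner ?M q e * e x)"
      unfolding elim(2) by (subst sum_Sigma_snd[where g = "\<lambda>e. L2_inner ?M q e * e x"]) (simp_all add: fE)
    also have "\<dots> = (\<Sum>m\<le>n. \<Sum>e\<in>E m. L2_inner ?M p e * e x)"
      by (intro sum.cong refl) (simp add: inner)
    finally have "p x = (\<Sum>m\<le>Suc n. \<Sum>e\<in>E m. L2_inner ?M p e * e x)"
      by simp
    then show ?case
        by (subst sum_Sigma_snd[where g = "\<lambda>e. L2_inner ?M p e * e x"]) (simp_all add: fE)
  qed
qed

text \<open>Within one degree this is part of \<open>orth_basis\<close>; across degrees the element
  of higher degree is orthogonal to every polynomial of lower degree.\<close>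

lemma orth_basis_orthonormal:
  assumes E: "\<And>n. orth_basis \<mu> n (E n)"
  shows "orthonormal_on (weighted \<mu>) (Sigma {..n} E) snd"
  unfolding orthonormal_on_def
proof (intro conjI ballI)
  show "finite (Sigma {..n} E)"
    using orth_basisD(5)[OF E] by blast
  fix i assume i: "i \<in> Sigma {..n} E"
  then show "snd i \<in> L2 (weighted \<mu>)"
    using orth_basisD(3)[OF E] by auto
  fix j assume j: "j \<in> Sigma {..n} E"
  have lower: "L2_inner (weighted \<mu>) e u = 0" "L2_inner (weighted \<mu>) u e = 0"
    if "e \<in> E l" "u \<in> E m" "m < l" for l m e u
  proof -
    show "L2_inner (weighted \<mu>) e u = 0"
      using orth_basisD(1)[OF E that(1)] orth_basisD(2)[OF E that(2)] that(3)
      by (auto simp: orth_polys_def)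
    then show "L2_inner (weighted \<mu>) u e = 0"
      using L2_inner_commute[of "weighted \<mu>" u e] by simp
  qed
  show "L2_inner (weighted \<mu>) (snd i) (snd j) = (if i = j then 1 else 0)"
  proof (cases "fst i" "fst j" rule: linorder_cases)
    case equal
    then show ?thesis
      using i j orthonormal_onD(3)[OF orth_basisD(4)[OF E]] by (auto simp: prod_eq_iff)
  qed (use i j lower in auto)
qed

text \<open>The remainder \<open>q\<close> left by \<open>orth_basis\<close> has lower degree, but
  almost everywhere it equals the difference of \<open>p\<close> and its expansion, an orthogonal
  polynomial of degree \<open>n\<close>. Thus \<open>q\<close> is orthogonal to itself.\<close>

lemma orth_basis_expansion_orth:
  fixes p :: "real ^ 'd \<Rightarrow> complex"
  assumes fin: "finite_measure (weighted \<mu> :: (real ^ 'd) measure)"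
    and E: "orth_basis \<mu> n E" and p: "p \<in> orth_polys \<mu> n"
  shows "AE x in weighted \<mu>. p x = (\<Sum>e\<in>E. L2_inner (weighted \<mu>) p e * e x)"
proof -
  let ?M = "weighted \<mu> :: (real ^ 'd) measure"
  obtain q where q: "q \<in> (if n = 0 then {\<lambda>x. 0} else polys (n - 1))"
    and pq: "AE x in ?M. p x - q x = (\<Sum>e\<in>E. L2_inner ?M p e * e x)"
    using E p by (auto simp: orth_basis_def orth_polys_def)
  have qn: "q \<in> polys n"
    using q by (auto simp: polys_zero elim: polys_mono split: if_splits)
  have L: "p \<in> L2 ?M" "q \<in> L2 ?M" "(\<lambda>x. \<Sum>e\<in>E. L2_inner ?M p e * e x) \<in> L2 ?M"
    using L2_polys[OF fin] orth_polys_polys[OF p] qn orth_basis_lincomb[OF E] by auto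
  have "L2_inner ?M (\<lambda>x. p x - (\<Sum>e\<in>E. L2_inner ?M p e * e x)) q = 0"
  proof -
    have "L2_inner ?M q (\<lambda>x. p x - (\<Sum>e\<in>E. L2_inner ?M p e * e x)) = 0"
      by (rule orth_polys_inner_lower[OF _ q])
        (intro orth_polys_diff[OF fin] p orth_polys_lincomb[OF fin] orth_basisD(1)[OF E])
    then show ?thesis
      by (subst L2_inner_commute) simp
  qed
  moreover have "L2_inner ?M (\<lambda>x. p x - (\<Sum>e\<in>E. L2_inner ?M p e * e x)) q = L2_inner ?M q q"
    using L pq by (intro L2_inner_cong_AE L2_diff) (auto simp: algebra_simps)
  ultimately have "L2_norm ?M q = 0"
    by (simp add: L2_inner_self)
  from L2_norm_zero_imp_AE[OF L(2) this] pq show ?thesis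
    by eventually_elim simp
qed

section \<open>Representation and uniqueness of the projection kernels\<close>

lemma is_orth_proj_unique:
  fixes f :: "real ^ 'd \<Rightarrow> complex"
  assumes fin: "finite_measure (weighted \<mu> :: (real ^ 'd) measure)" and f: "f \<in> L2 (weighted \<mu>)"
    and p: "is_orth_proj \<mu> n f p" and q: "is_orth_proj \<mu> n f q" and x: "x \<in> unit_ball"
  shows "p x = q x"
proof -
  let ?M = "weighted \<mu> :: (real ^ 'd) measure"
  define r where "r = (\<lambda>x. p x - q x)"
  have pq: "p \<in> orth_polys \<mu> n" "q \<in> orth_polys \<mu> n"
    using p q by (auto simp: is_orth_proj_def)
  then have r: "r \<in> orth_polys \<mu> n"
    unfolding r_def by (rule orth_polys_diff[OF fin])
  have L: "p \<in> L2 ?M" "q \<in> L2 ?M" "r \<in> L2 ?M"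
    using pq r L2_polys[OF fin] by (auto intro: orth_polys_polys)
  have "L2_inner ?M r r = L2_inner ?M (\<lambda>x. (f x - q x) - (f x - p x)) r"
    by (simp add: r_def)
  also have "\<dots> = L2_inner ?M (\<lambda>x. f x - q x) r - L2_inner ?M (\<lambda>x. f x - p x) r"
    by (intro L2_inner_diff_left L2_diff f L)
  also have "\<dots> = 0"
    using p q r by (simp add: is_orth_proj_def)
  finally have "L2_norm ?M r = 0"
    by (simp add: L2_inner_self)
  then have "AE x in ?M. r x = 0"
    by (rule L2_norm_zero_imp_AE[OF L(3)])
  then have "r x = 0"
    using x by (rule continuous_AE_zero[OF continuous_on_polys[OF orth_polys_polys[OF r]]])
  then show ?thesis
    by (simp add: r_def)
qed

lemma poly_kernel_slice:
  assumes "poly_kernel P"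
  shows "\<exists>N. P x \<in> polys N"
proof -
  obtain N c where "P = (\<lambda>x y. \<Sum>k\<in>multi_idx N. \<Sum>l\<in>multi_idx N. c k l * monomial k x * monomial l y)"
    using assms unfolding poly_kernel_def by (elim exE)
  then have "P x = (\<lambda>y. \<Sum>k\<in>multi_idx N. \<Sum>l\<in>multi_idx N. c k l * monomial k x * monomial l y)"
    by (rule fun_cong)
  also have "\<dots> \<in> polys N"
    by (intro polys_sum polys_cmult polys_monomial)
  finally show ?thesis ..
qed

lemma poly_kernel_sum:
  assumes "\<And>e. e \<in> E \<Longrightarrow> e \<in> polys n"
  shows "poly_kernel (\<lambda>x y. a * (\<Sum>e\<in>E. e x * cnj (e y)))"
proof -
  obtain c where c: "\<And>e. e \<in> E \<Longrightarrow> e = (\<lambda>x. \<Sum>k\<in>multi_idx n. c e k * monomial k x)"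
    using assms unfolding polys_def mem_Collect_eq by metis
  have "a * (\<Sum>e\<in>E. e x * cnj (e y)) = (\<Sum>k\<in>multi_idx n. \<Sum>l\<in>multi_idx n.
      (a * (\<Sum>e\<in>E. c e k * cnj (c e l))) * monomial k x * monomial l y)" for x y
  proof -
    have "(\<Sum>e\<in>E. e x * cnj (e y)) =
        (\<Sum>e\<in>E. \<Sum>k\<in>multi_idx n. \<Sum>l\<in>multi_idx n. (c e k * cnj (c e l)) * (monomial k x * monomial l y))"
    proof (rule sum.cong[OF refl])
      fix e assume "e \<in> E"
      from c[OF this] have ex: "e z = (\<Sum>k\<in>multi_idx n. c e k * monomial k z)" for z
        by (rule fun_cong)
      show "e x * cnj (e y) =
          (\<Sum>k\<in>multi_idx n. \<Sum>l\<in>multi_idx n. (c e k * cnj (c e l)) * (monomial k x * monomial l y))"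
        by (simp only: ex cnj_sum complex_cnj_mult cnj_monomial sum_product ac_simps)
    qed
    also have "\<dots> = (\<Sum>k\<in>multi_idx n. \<Sum>l\<in>multi_idx n. \<Sum>e\<in>E. (c e k * cnj (c e l)) * (monomial k x * monomial l y))"
      by (subst sum.swap, rule sum.cong[OF refl], rule sum.swap)
    finally show ?thesis
      by (simp only: sum_distrib_left sum_distrib_right mult.assoc)
  qed
  then show ?thesis
    unfolding poly_kernel_def by (intro exI[of _ n] exI ext)
qed

text \<open>Existence of a kernel as required in \<open>proj_kernel\<close>: the factor
  \<open>inverse (ball_const TYPE('d) \<mu>)\<close> cancels the normalisation in front of the
  integral, and what remains is the Fourier sum over \<open>E\<close>.\<close>

lemma orth_basis_kernel:
  fixes E :: "(real ^ 'd \<Rightarrow> complex) set"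
  assumes fin: "finite_measure (weighted \<mu> :: (real ^ 'd) measure)"
    and b: "ball_const TYPE('d) \<mu> \<noteq> 0" and E: "orth_basis \<mu> n E" and f: "f \<in> L2 (weighted \<mu>)"
  shows "is_orth_proj \<mu> n f (\<lambda>x. complex_of_real (ball_const TYPE('d) \<mu>) * (LINT y|weighted \<mu>.
    f y * (complex_of_real (inverse (ball_const TYPE('d) \<mu>)) * (\<Sum>e\<in>E. e x * cnj (e y)))))"
proof -
  let ?M = "weighted \<mu> :: (real ^ 'd) measure"
  have "complex_of_real (ball_const TYPE('d) \<mu>) * (LINT y|?M.
      f y * (complex_of_real (inverse (ball_const TYPE('d) \<mu>)) * (\<Sum>e\<in>E. e x * cnj (e y)))) =
      (\<Sum>e\<in>E. L2_inner ?M f e * e x)" for x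
  proof -
    have "(LINT y|?M. f y * (complex_of_real (inverse (ball_const TYPE('d) \<mu>)) * (\<Sum>e\<in>E. e x * cnj (e y)))) =
        (LINT y|?M. complex_of_real (inverse (ball_const TYPE('d) \<mu>)) * (\<Sum>e\<in>E. e x * (f y * cnj (e y))))"
      by (simp add: sum_distrib_left ac_simps)
    also have "\<dots> = complex_of_real (inverse (ball_const TYPE('d) \<mu>)) * (\<Sum>e\<in>E. e x * L2_inner ?M f e)"
      unfolding L2_inner_def integral_mult_right_zero
      by (subst Bochner_Integration.integral_sum)
        (auto intro!: integrable_mult_right L2_mult_integrable f orth_basisD(3)[OF E])
    finally show ?thesis
      using b by (simp add: mult.commute)
  qed
  moreover have "is_orth_proj \<mu> n f (\<lambda>x. \<Sum>e\<in>E. L2_inner ?M f e * e x)"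
    unfolding is_orth_proj_def
  proof (intro conjI ballI)
    show "(\<lambda>x. \<Sum>e\<in>E. L2_inner ?M f e * e x) \<in> orth_polys \<mu> n"
      by (intro orth_polys_lincomb[OF fin] orth_basisD(1)[OF E])
    fix q :: "real ^ 'd \<Rightarrow> complex" assume q: "q \<in> orth_polys \<mu> n"
    have L: "(\<lambda>x. \<Sum>e\<in>E. L2_inner ?M f e * e x) \<in> L2 ?M" "q \<in> L2 ?M"
      using L2_polys[OF fin] orth_polys_polys[OF q] orth_basis_lincomb[OF E] by auto
    have zero: "L2_inner ?M (\<lambda>x. f x - (\<Sum>e\<in>E. L2_inner ?M f e * e x)) e = 0" if "e \<in> E" for e
      using orthonormal_inner_lincomb[OF orth_basisD(4)[OF E] that] f L orth_basisD(3)[OF E that]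
      by (simp add: L2_inner_diff_left)
    have "L2_inner ?M (\<lambda>x. f x - (\<Sum>e\<in>E. L2_inner ?M f e * e x)) q =
        L2_inner ?M (\<lambda>x. f x - (\<Sum>e\<in>E. L2_inner ?M f e * e x)) (\<lambda>x. \<Sum>e\<in>E. L2_inner ?M q e * e x)"
      using orth_basis_expansion_orth[OF fin E q] f L
      by (intro L2_inner_cong_AE L2_diff L2_lincomb) (auto intro: orth_basisD(3)[OF E])
    also have "\<dots> = 0"
      using f L by (subst L2_inner_lincomb_right) (auto intro: orth_basisD(3)[OF E] L2_diff simp: zero)
    finally show "L2_inner ?M (\<lambda>x. f x - (\<Sum>e\<in>E. L2_inner ?M f e * e x)) q = 0" .
  qed
  ultimately show ?thesis
    by simp
qed

text \<open>At a fixed \<open>x\<close> in the ball the value of the projection is unique, so both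
  kernels have the same integrals against every \<open>f\<close>. As the integral carries no
  conjugation, the test function is the conjugate of their difference in \<open>y\<close>; this
  difference has norm zero and, being a polynomial, vanishes on the ball.\<close>

lemma proj_kernel_eq:
  fixes E :: "(real ^ 'd \<Rightarrow> complex) set"
  assumes fin: "finite_measure (weighted \<mu> :: (real ^ 'd) measure)"
    and b: "ball_const TYPE('d) \<mu> \<noteq> 0" and E: "orth_basis \<mu> n E"
    and x: "x \<in> unit_ball" and y: "y \<in> unit_ball"
  shows "complex_of_real (ball_const TYPE('d) \<mu>) * proj_kernel \<mu> n x y = (\<Sum>e\<in>E. e x * cnj (e y))"
proof -
  let ?M = "weighted \<mu> :: (real ^ 'd) measure"
  let ?b = "complex_of_real (ball_const TYPE('d) \<mu>)"
  define K where "K = (\<lambda>x y. complex_of_real (inverse (ball_const TYPE('d) \<mu>)) * (\<Sum>e\<in>E. e x * cnj (e y)))"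
  define P where "P = (proj_kernel \<mu> n :: real ^ 'd \<Rightarrow> real ^ 'd \<Rightarrow> complex)"
  have K: "poly_kernel K" "\<And>f. f \<in> L2 ?M \<Longrightarrow> is_orth_proj \<mu> n f (\<lambda>x. ?b * (LINT y|?M. f y * K x y))"
    unfolding K_def using orth_basis_kernel[OF fin b E] by (auto intro: poly_kernel_sum orth_basisD(2)[OF E])
  \<comment> \<open>The explicit kernel \<open>K\<close> is the witness that lets the choice in
    \<open>proj_kernel\<close> inherit its defining property.\<close>
  have "poly_kernel P \<and> (\<forall>f\<in>L2 ?M. is_orth_proj \<mu> n f (\<lambda>x. ?b * (LINT y|?M. f y * P x y)))"
    unfolding P_def proj_kernel_def by (rule someI[of _ K], intro conjI ballI K)
  then have P: "poly_kernel P" "\<And>f. f \<in> L2 ?M \<Longrightarrow> is_orth_proj \<mu> n f (\<lambda>x. ?b * (LINT y|?M. f y * P x y))"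
    by auto
  obtain N N' where N: "P x \<in> polys N" "K x \<in> polys N'"
    using poly_kernel_slice P(1) K(1) by metis
  define g where "g = (\<lambda>y. P x y - K x y)"
  have g: "g \<in> polys (max N N')"
    unfolding g_def using N by (intro polys_diff) (auto elim: polys_mono)
  define f where "f = (\<lambda>y. cnj (g y))"
  have L: "P x \<in> L2 ?M" "K x \<in> L2 ?M" "g \<in> L2 ?M" "f \<in> L2 ?M"
    using N g L2_polys[OF fin] polys_cnj[OF g] by (auto simp: f_def)
  have int: "integrable ?M (\<lambda>y. f y * h y)" if "h \<in> polys m" for h m
    using L2_mult_integrable[OF L(4) L2_polys[OF fin polys_cnj[OF that]]] by simp
  have "?b * (LINT y|?M. f y * P x y) = ?b * (LINT y|?M. f y * K x y)"
    using is_orth_proj_unique[OF fin L(4) P(2)[OF L(4)] K(2)[OF L(4)] x] .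
  then have "(LINT y|?M. f y * P x y - f y * K x y) = 0"
    using b int N by (subst Bochner_Integration.integral_diff) auto
  then have "L2_inner ?M g g = 0"
    by (simp add: L2_inner_def f_def g_def algebra_simps)
  then have "L2_norm ?M g = 0"
    by (simp add: L2_inner_self)
  then have "AE y in ?M. g y = 0"
    by (rule L2_norm_zero_imp_AE[OF L(3)])
  then have "g y = 0"
    using y by (rule continuous_AE_zero[OF continuous_on_polys[OF g]])
  then have "proj_kernel \<mu> n x y = K x y"
    by (simp add: g_def P_def)
  then show ?thesis
    using b by (simp add: K_def)
qed

section \<open>Bessel's inequality and Parseval's identity for the orthogonal polynomials\<close>

lemma orth_basis_bessel:
  fixes f :: "real ^ 'd \<Rightarrow> complex"
  assumes E: "\<And>n. orth_basis \<mu> n (E n)" and f: "f \<in> L2 (weighted \<mu>)"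
  shows "(\<Sum>n\<le>N. \<Sum>e\<in>E n. (cmod (L2_inner (weighted \<mu>) f e))\<^sup>2) \<le> (L2_norm (weighted \<mu>) f)\<^sup>2"
proof -
  have "0 \<le> (L2_norm (weighted \<mu>) (\<lambda>x. f x - (\<Sum>i\<in>Sigma {..N} E. L2_inner (weighted \<mu>) f (snd i) * snd i x)))\<^sup>2"
    by simp
  then show ?thesis
    using orth_basisD(5)[OF E] unfolding orthonormal_norm_diff[OF orth_basis_orthonormal[OF E] f]
    by (simp add: sum_Sigma_snd[where g = "\<lambda>e. (cmod (L2_inner (weighted \<mu>) f e))\<^sup>2"])
qed

text \<open>Bessel's inequality bounds the partial sums from above. For \<open>c\<close> below the
  limit, density provides a polynomial of some degree \<open>N\<close> with squared error less than
  the gap; the Fourier sum up to \<open>N\<close> does at least as well, so the partial sums exceed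
  \<open>c\<close> from \<open>N\<close> on.\<close>

lemma orth_basis_parseval:
  fixes f :: "real ^ 'd \<Rightarrow> complex"
  assumes fin: "finite_measure (weighted \<mu> :: (real ^ 'd) measure)"
    and E: "\<And>n. orth_basis \<mu> n (E n)" and f: "f \<in> L2 (weighted \<mu>)"
  shows "(\<lambda>N. \<Sum>n\<le>N. \<Sum>e\<in>E n. (cmod (L2_inner (weighted \<mu>) f e))\<^sup>2)
    \<longlonglongrightarrow> (L2_norm (weighted \<mu>) f)\<^sup>2"
proof -
  let ?M = "weighted \<mu> :: (real ^ 'd) measure"
  define s where "s = (\<lambda>n. \<Sum>e\<in>E n. (cmod (L2_inner ?M f e))\<^sup>2)"
  have s_nonneg: "0 \<le> s n" for n
    unfolding s_def by (intro sum_nonneg) simp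
  have bessel: "(\<Sum>n\<le>N. s n) \<le> (L2_norm ?M f)\<^sup>2" for N
    unfolding s_def by (rule orth_basis_bessel[OF E f])
  have "(\<lambda>N. \<Sum>n\<le>N. s n) \<longlonglongrightarrow> (L2_norm ?M f)\<^sup>2"
  proof (rule order_tendstoI)
    fix c assume "c < (L2_norm ?M f)\<^sup>2"
    then obtain N p where p: "p \<in> polys N" "(L2_norm ?M (\<lambda>x. f x - p x))\<^sup>2 < (L2_norm ?M f)\<^sup>2 - c"
      using polys_dense[OF fin f, of "(L2_norm ?M f)\<^sup>2 - c"] by auto
    define d :: "nat \<times> (real ^ 'd \<Rightarrow> complex) \<Rightarrow> complex" where "d = (\<lambda>i. L2_inner ?M p (snd i))"
    note on = orth_basis_orthonormal[OF E, where n = N]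
    have pL: "p \<in> L2 ?M"
      by (rule L2_polys[OF fin p(1)])
    have sL: "(\<lambda>x. \<Sum>i\<in>Sigma {..N} E. d i * snd i x) \<in> L2 ?M"
      by (intro L2_lincomb orthonormal_onD(2)[OF on])
    have "L2_norm ?M (\<lambda>x. f x - p x) = L2_norm ?M (\<lambda>x. f x - (\<Sum>i\<in>Sigma {..N} E. d i * snd i x))"
      using orth_basis_expansion[OF fin E p(1)] 
      by (intro L2_norm_cong_AE L2_diff f pL sL) (simp add: d_def)
    moreover have "(L2_norm ?M f)\<^sup>2 - (\<Sum>i\<in>Sigma {..N} E. (cmod (L2_inner ?M f (snd i)))\<^sup>2) \<le>
        (L2_norm ?M (\<lambda>x. f x - (\<Sum>i\<in>Sigma {..N} E. d i * snd i x)))\<^sup>2"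
      unfolding orthonormal_norm_diff[OF on f] by (simp add: sum_nonneg)
    moreover have "(\<Sum>i\<in>Sigma {..N} E. (cmod (L2_inner ?M f (snd i)))\<^sup>2) = (\<Sum>n\<le>N. s n)"
      unfolding s_def using orth_basisD(5)[OF E]
      by (subst sum_Sigma_snd[where g = "\<lambda>e. (cmod (L2_inner ?M f e))\<^sup>2"]) simp_all
    ultimately have "c < (\<Sum>n\<le>N. s n)"
      using p(2) by simp
    moreover have "(\<Sum>n\<le>N. s n) \<le> (\<Sum>n\<le>N'. s n)" if "N \<le> N'" for N'
      using that s_nonneg by (intro sum_mono2) auto
    ultimately show "eventually (\<lambda>N. c < (\<Sum>n\<le>N. s n)) sequentially"
      unfolding eventually_sequentially by (intro exI[of _ N]) (auto intro: less_le_trans)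
  next
    fix c assume "(L2_norm ?M f)\<^sup>2 < c"
    then show "eventually (\<lambda>N. (\<Sum>n\<le>N. s n) < c) sequentially"
      using bessel by (intro always_eventually allI) (rule le_less_trans)
  qed
  then show ?thesis
    by (simp add: s_def)
qed


section \<open>The cutoff function\<close>

text \<open>The support condition alone says nothing at the endpoints 1/2 and 2; continuity carries
  the value 0 over to them.\<close>

lemma cutoff_zero:
  assumes a: "needlet_cutoff a" and t: "0 \<le> t" "t \<le> 1/2 \<or> 2 \<le> t"
  shows "a t = 0"
proof -
  obtain D where "D 0 = a" "\<And>n t. t \<in> {0..} \<Longrightarrow> (D n has_real_derivative D (Suc n) t) (at t within {0..})"
    using a unfolding needlet_cutoff_def smooth_on_set_def by blast
  then have cont: "continuous_on {0..} a"
    by (metis DERIV_continuous_on)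
  have supp: "closure {t. t \<ge> 0 \<and> a t \<noteq> 0} \<subseteq> {1/2..2}"
    using a by (simp add: needlet_cutoff_def)
  have zero: "a u = 0" if "0 \<le> u" "u < 1/2 \<or> 2 < u" for u
  proof (rule ccontr)
    assume "a u \<noteq> 0"
    then have "u \<in> {1/2..2}"
      using that supp closure_subset[of "{t. t \<ge> 0 \<and> a t \<noteq> 0}"] by blast
    then show False
      using that by simp
  qed
  show ?thesis
  proof (cases "t \<le> 1/2")
    case True
    show ?thesis
      by (rule continuous_constant_on_closure[of "{0..<1/2}"])
        (use t True zero in \<open>auto intro: continuous_on_subset[OF cont]\<close>)
  next
    case False
    show ?thesis
      by (rule continuous_constant_on_closure[of "{2<..}"])
        (use t False zero in \<open>auto intro: continuous_on_subset[OF cont]\<close>)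
  qed
qed

lemma cutoff_partition:
  assumes "needlet_cutoff a" "1 \<le> x" "x \<le> 2"
  shows "(a x)\<^sup>2 + (a (x / 2))\<^sup>2 = 1"
proof -
  have "x / 2 \<in> {1/2..1}"
    using assms by auto
  then have "(a (x / 2))\<^sup>2 + (a (2 * (x / 2)))\<^sup>2 = 1"
    using assms(1) unfolding needlet_cutoff_def by blast
  then show ?thesis
    by simp
qed

text \<open>From the second halving of \<open>x\<close> on, the argument is at most 1/2, where the
  cutoff vanishes.\<close>

lemma cutoff_sum_tail:
  assumes "needlet_cutoff a" "1 \<le> x" "x \<le> 2"
  shows "(\<Sum>k<Suc n. (a (x / 2 / 2 ^ k))\<^sup>2) = (a (x / 2))\<^sup>2"
proof -
  have "(a (x / 2 / 2 ^ Suc k))\<^sup>2 = 0" for k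
  proof -
    have "x / 2 / 2 ^ Suc k \<le> 1 / 2"
      using order_trans[OF assms(3), of "2 * 2 ^ k"] by (simp add: field_simps)
    then show ?thesis
      using cutoff_zero[OF assms(1), of "x / 2 / 2 ^ Suc k"] assms by simp
  qed
  then show ?thesis
    unfolding sum.lessThan_Suc_shift by simp
qed

text \<open>Halving \<open>x\<close> shifts the dilations by one; both inductions that follow run on
  this recursion.\<close>

lemma cutoff_sum_Suc: "(\<Sum>k<Suc n. (a (x / 2 ^ k))\<^sup>2) = (a x)\<^sup>2 + (\<Sum>k<n. (a (x / 2 / 2 ^ k))\<^sup>2)"
  for a :: "real \<Rightarrow> real"
  unfolding sum.lessThan_Suc_shift by simp

lemma cutoff_sum_le:
  assumes "needlet_cutoff a" "1 \<le> x"
  shows "(\<Sum>k<n. (a (x / 2 ^ k))\<^sup>2) \<le> 1"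
  using assms(2)
proof (induction n arbitrary: x)
  case (Suc n)
  show ?case
  proof (cases "2 \<le> x")
    case True
    then show ?thesis
      using Suc.IH[of "x / 2"] cutoff_zero[OF assms(1), of x] unfolding cutoff_sum_Suc by simp
  next
    case False
    have "(\<Sum>k<n. (a (x / 2 / 2 ^ k))\<^sup>2) \<le> (\<Sum>k<Suc n. (a (x / 2 / 2 ^ k))\<^sup>2)"
      by simp
    then show ?thesis
      using False Suc.prems cutoff_sum_tail[OF assms(1), of x n] cutoff_partition[OF assms(1), of x]
      unfolding cutoff_sum_Suc by linarith
  qed
qed simp

text \<open>As long as \<open>x\<close> is at least 2 the first term is zero and \<open>x\<close>
  can be halved. The bound \<open>2 ^ n\<close> ensures that the interval from 1 to 2 is reached
  before the terms run out.\<close>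

lemma cutoff_sum_eq:
  assumes "needlet_cutoff a" "1 \<le> x" "x \<le> 2 ^ n"
  shows "(\<Sum>k<Suc n. (a (x / 2 ^ k))\<^sup>2) = 1"
  using assms(2,3)
proof (induction n arbitrary: x)
  \<comment> \<open>Only the argument 1 remains; its partner in the partition of unity is 1/2, where
    the cutoff is zero.\<close>
  case 0
  then have "x = 1" by simp
  then show ?case
    using cutoff_partition[OF assms(1), of 1] cutoff_zero[OF assms(1), of "1/2"] by simp
next
  case (Suc n)
  show ?case
  proof (cases "2 \<le> x")
    case True
    then show ?thesis
      using Suc.IH[of "x / 2"] Suc.prems cutoff_zero[OF assms(1), of x]
      unfolding cutoff_sum_Suc[of _ _ "Suc n"] by simp
  next
    case False
    then show ?thesis
      using Suc.prems cutoff_sum_tail[OF assms(1), of x n] cutoff_partition[OF assms(1), of x]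
      unfolding cutoff_sum_Suc[of _ _ "Suc n"] by linarith
  qed
qed


section \<open>The needlet system\<close>

lemma ball_const_inverse:
  "inverse (ball_const TYPE('d::finite) \<mu>) = measure (weighted \<mu> :: (real ^ 'd) measure) (space (weighted \<mu> :: (real ^ 'd) measure))"
proof -
  have "measure (weighted \<mu> :: (real ^ 'd) measure) (space (weighted \<mu> :: (real ^ 'd) measure)) =
      (LINT x|(weighted \<mu> :: (real ^ 'd) measure). 1)"
    by simp
  also have "\<dots> = (LINT x|lebesgue_on unit_ball. weight \<mu> (x :: real ^ 'd) *\<^sub>R 1)"
    unfolding weighted_def using weight_measurable weight_nonneg by (intro integral_density) auto
  also have "\<dots> = (LINT x:unit_ball|lebesgue. weight \<mu> (x :: real ^ 'd))"
    by (subst integral_restrict_space) (auto simp: set_lebesgue_integral_def)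
  finally show ?thesis
    by (simp add: ball_const_def)
qed

text \<open>
  Integrability of the weight comes for free from the quadrature formula: an infinite measure would
  give the constant \<open>1\<close> the Bochner integral \<open>0\<close>, whereas the coefficients have a positive sum.
\<close>

lemma needlet_cubature_finite_measure:
  fixes X :: "nat \<Rightarrow> (real ^ 'd) set"
  assumes "needlet_cubature \<mu> c\<^sub>1 c\<^sub>2 c\<^sub>3 X lam"
  shows "finite_measure (weighted \<mu> :: (real ^ 'd) measure)" "ball_const TYPE('d) \<mu> > 0"
proof -
  let ?M = "weighted \<mu> :: (real ^ 'd) measure"
  \<comment> \<open>Comparability of the number of points with \<open>2 ^ (j * CARD('d))\<close> at
    \<open>j = 0\<close>, where the power is 1; it forces \<open>X 0\<close> to be nonempty.\<close>
  obtain c where "1 \<le> c * real (card (X 0))"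
    using assms unfolding needlet_cubature_def comparable_on_def
    by (metis UNIV_I mult_zero_left power_0)
  then have "X 0 \<noteq> {}"
    by auto
  moreover have "finite (X 0)" "\<And>\<xi>. \<xi> \<in> X 0 \<Longrightarrow> 0 < lam 0 \<xi>"
    using assms by (auto simp: needlet_cubature_def)
  ultimately have pos: "0 < (\<Sum>\<xi>\<in>X 0. lam 0 \<xi>)"
    by (intro sum_pos)
  have "(LINT x|?M. p x) = (\<Sum>\<xi>\<in>X 0. complex_of_real (lam 0 \<xi>) * p \<xi>)" if "p \<in> polys (2 ^ (0 + 2))" for p
    using assms that unfolding needlet_cubature_def by blast
  from this[OF polys_const[of 1]]
  have "(LINT x|?M. complex_of_real 1) = complex_of_real (\<Sum>\<xi>\<in>X 0. lam 0 \<xi>)"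
    by simp
  then have int: "(LINT x|?M. 1 :: real) = (\<Sum>\<xi>\<in>X 0. lam 0 \<xi>)"
    unfolding integral_complex_of_real of_real_eq_iff .
  with pos have "integrable ?M (\<lambda>x. 1 :: real)"
    using not_integrable_integral_eq[of ?M "\<lambda>x. 1 :: real"] by auto
  then show "finite_measure ?M"
    by (auto simp: integrable_iff_bounded less_top[symmetric] intro!: finite_measureI)
  have "0 < inverse (ball_const TYPE('d) \<mu>)"
    using int pos by (simp add: ball_const_inverse)
  then show "ball_const TYPE('d) \<mu> > 0"
    by simp
qed

text \<open>The elements of \<open>E\<close> are constants, so the coefficient of 1 at
  \<open>e\<close> is \<open>cnj (e y)\<close> times the total mass, which is the inverse of
  \<open>ball_const\<close>. Expanding the constant 1 therefore evaluates the kernel, and level 0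
  fits the scheme of the other levels.\<close>

lemma orth_basis_0_kernel:
  fixes E :: "(real ^ 'd \<Rightarrow> complex) set"
  assumes fin: "finite_measure (weighted \<mu> :: (real ^ 'd) measure)"
    and b: "ball_const TYPE('d) \<mu> \<noteq> 0" and E: "orth_basis \<mu> 0 E"
  shows "(\<Sum>e\<in>E. e x * cnj (e y)) = complex_of_real (ball_const TYPE('d) \<mu>)"
proof -
  let ?M = "weighted \<mu> :: (real ^ 'd) measure"
  let ?b = "complex_of_real (ball_const TYPE('d) \<mu>)"
  interpret finite_measure ?M by fact
  define p where "p = (\<lambda>x :: real ^ 'd. 1 - inverse ?b * (\<Sum>e\<in>E. cnj (e y) * e x))"
  have e_const: "e u = e v" if "e \<in> E" for e u v
    by (rule polys_0_const[OF orth_basisD(2)[OF E that]])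
  have inner: "L2_inner ?M (\<lambda>x. 1) e = inverse ?b * cnj (e y)" if "e \<in> E" for e
  proof -
    have "L2_inner ?M (\<lambda>x. 1) e = (LINT x|?M. cnj (e y))"
      unfolding L2_inner_def
    proof (rule Bochner_Integration.integral_cong[OF refl])
      fix x
      show "1 * cnj (e x) = cnj (e y)"
        unfolding e_const[OF that, of x y] by simp
    qed
    then show ?thesis
      using ball_const_inverse[where 'd = 'd, of \<mu>] by (simp add: scaleR_conv_of_real flip: of_real_inverse)
  qed
  have p: "p \<in> polys 0"
    unfolding p_def by (intro polys_diff polys_const polys_cmult polys_lincomb orth_basisD(2)[OF E])
  have "AE x in ?M. 1 = (\<Sum>e\<in>E. L2_inner ?M (\<lambda>x. 1) e * e x)"
    using E polys_const[of 1 0] by (auto simp: orth_basis_def)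
  then have "AE x in ?M. p x = 0"
  proof (rule AE_mp, intro AE_I2 impI)
    fix x assume "1 = (\<Sum>e\<in>E. L2_inner ?M (\<lambda>x. 1) e * e x)"
    also have "\<dots> = inverse ?b * (\<Sum>e\<in>E. cnj (e y) * e x)"
      unfolding sum_distrib_left by (intro sum.cong) (simp_all add: inner)
    finally show "p x = 0"
      by (simp add: p_def)
  qed
  then have "p 0 = 0"
    by (rule continuous_AE_zero[OF continuous_on_polys[OF p]]) simp
  then have "p x = 0"
    using polys_0_const[OF p, of x 0] by simp
  then show ?thesis
    using b by (simp add: p_def field_simps mult.commute)
qed

text \<open>At level \<open>Suc k\<close> the cutoff vanishes once \<open>\<nu> / 2 ^ k\<close>
  reaches 2, so the series stops at degree \<open>2 ^ Suc k\<close>. Both points are taken in the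
  ball, where \<open>proj_kernel_eq\<close> applies.\<close>

lemma needlet_kernel_expansion:
  fixes E :: "nat \<Rightarrow> (real ^ 'd \<Rightarrow> complex) set"
  assumes fin: "finite_measure (weighted \<mu> :: (real ^ 'd) measure)"
    and b: "ball_const TYPE('d) \<mu> \<noteq> 0" and E: "\<And>n. orth_basis \<mu> n (E n)"
    and a: "needlet_cutoff a" and x: "x \<in> unit_ball" and y: "y \<in> unit_ball"
  shows "needlet_kernel \<mu> a 0 x y = (\<Sum>i\<in>Sigma {..0} E. snd i x * cnj (snd i y))"
    and "needlet_kernel \<mu> a (Suc k) x y =
      (\<Sum>i\<in>Sigma {..2 ^ Suc k} E. complex_of_real (a (real (fst i) / 2 ^ k)) * (snd i x * cnj (snd i y)))"
proof -
  show "needlet_kernel \<mu> a 0 x y = (\<Sum>i\<in>Sigma {..0} E. snd i x * cnj (snd i y))"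
    using orth_basis_0_kernel[OF fin b E] orth_basisD(5)[OF E]
    by (subst sum_Sigma_snd[where g = "\<lambda>e. e x * cnj (e y)"]) (simp_all add: needlet_kernel_def)
  have "(\<Sum>\<nu>. complex_of_real (a (real \<nu> / 2 ^ k)) * proj_kernel \<mu> \<nu> x y) =
      (\<Sum>\<nu>\<le>2 ^ Suc k. complex_of_real (a (real \<nu> / 2 ^ k)) * proj_kernel \<mu> \<nu> x y)"
  proof (rule suminf_finite)
    fix \<nu> assume "\<nu> \<notin> {..(2::nat) ^ Suc k}"
    then have "real (2 ^ Suc k) \<le> real \<nu>"
      by (intro of_nat_mono) simp
    then have "2 \<le> real \<nu> / 2 ^ k"
      by (simp add: field_simps)
    then show "complex_of_real (a (real \<nu> / 2 ^ k)) * proj_kernel \<mu> \<nu> x y = 0"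
      using cutoff_zero[OF a, of "real \<nu> / 2 ^ k"] by simp
  qed simp
  then have "needlet_kernel \<mu> a (Suc k) x y = (\<Sum>\<nu>\<le>2 ^ Suc k. complex_of_real (a (real \<nu> / 2 ^ k)) *
      (complex_of_real (ball_const TYPE('d) \<mu>) * proj_kernel \<mu> \<nu> x y))"
    by (simp add: needlet_kernel_def sum_distrib_left mult.left_commute)
  also have "\<dots> = (\<Sum>\<nu>\<le>2 ^ Suc k. \<Sum>e\<in>E \<nu>. complex_of_real (a (real \<nu> / 2 ^ k)) * (e x * cnj (e y)))"
    by (simp only: proj_kernel_eq[OF fin b E x y] sum_distrib_left)
  also have "\<dots> = (\<Sum>i\<in>Sigma {..2 ^ Suc k} E. complex_of_real (a (real (fst i) / 2 ^ k)) * (snd i x * cnj (snd i y)))"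
    by (subst sum.Sigma) (simp_all add: orth_basisD(5)[OF E] split_beta)
  finally show "needlet_kernel \<mu> a (Suc k) x y = \<dots>" .
qed

text \<open>Degree bound \<open>N\<close> and multiplier \<open>\<alpha>\<close> are left open to
  treat level 0, with \<open>N = 0\<close> and multiplier 1, together with level
  \<open>Suc k\<close>, with \<open>N = 2 ^ Suc k\<close>. The hypothesis on \<open>N\<close> keeps
  the squared modulus of a polynomial of degree \<open>N\<close> within the exactness of the
  cubature.\<close>

lemma needlet_level:
  fixes E :: "nat \<Rightarrow> (real ^ 'd \<Rightarrow> complex) set" and \<alpha> :: "nat \<Rightarrow> real"
  assumes fin: "finite_measure (weighted \<mu> :: (real ^ 'd) measure)"
    and E: "\<And>n. orth_basis \<mu> n (E n)"
    and cub: "needlet_cubature \<mu> c\<^sub>1 c\<^sub>2 c\<^sub>3 X lam"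
    and N: "N + N \<le> 2 ^ (j + 2)"
    and kernel: "\<And>x y. x \<in> unit_ball \<Longrightarrow> y \<in> unit_ball \<Longrightarrow> needlet_kernel \<mu> a j x y =
      (\<Sum>i\<in>Sigma {..N} E. complex_of_real (\<alpha> (fst i)) * (snd i x * cnj (snd i y)))"
  shows "\<xi> \<in> X j \<Longrightarrow> needlet \<mu> a lam (j, \<xi>) \<in> L2 (weighted \<mu>)"
    and "f \<in> L2 (weighted \<mu>) \<Longrightarrow>
      (\<Sum>\<xi>\<in>X j. (cmod (L2_inner (weighted \<mu>) f (needlet \<mu> a lam (j, \<xi>))))\<^sup>2) =
      (\<Sum>\<nu>\<le>N. (\<alpha> \<nu>)\<^sup>2 * (\<Sum>e\<in>E \<nu>. (cmod (L2_inner (weighted \<mu>) f e))\<^sup>2))"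
proof -
  let ?M = "weighted \<mu> :: (real ^ 'd) measure"
  let ?I = "Sigma {..N} E"
  note on = orth_basis_orthonormal[OF E, where n = N]
  have X: "X j \<subseteq> unit_ball" and lam: "\<And>\<xi>. \<xi> \<in> X j \<Longrightarrow> 0 < lam j \<xi>"
    and quad: "\<And>p. p \<in> polys (2 ^ (j + 2)) \<Longrightarrow> (LINT x|?M. p x) = (\<Sum>\<xi>\<in>X j. complex_of_real (lam j \<xi>) * p \<xi>)"
    using cub unfolding needlet_cubature_def by blast+
  \<comment> \<open>A polynomial that coincides with the needlet on the ball; it inherits square
    integrability from the basis, and all inner products are computed with it.\<close>
  define \<psi> where "\<psi> = (\<lambda>\<xi> x. \<Sum>i\<in>?I. (complex_of_real (sqrt (lam j \<xi>) * \<alpha> (fst i)) * cnj (snd i \<xi>)) * snd i x)"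
  have \<psi>_eq: "needlet \<mu> a lam (j, \<xi>) x = \<psi> \<xi> x" if "\<xi> \<in> X j" "x \<in> space ?M" for \<xi> x
    using that X by (simp add: needlet_def \<psi>_def space_weighted kernel subset_iff sum_distrib_left ac_simps)
  have \<psi>L: "\<psi> \<xi> \<in> L2 ?M" for \<xi>
    unfolding \<psi>_def by (intro L2_lincomb orthonormal_onD(2)[OF on])
  show "needlet \<mu> a lam (j, \<xi>) \<in> L2 ?M" if "\<xi> \<in> X j" for \<xi>
    by (rule L2_cong[OF \<psi>L[of \<xi>] \<psi>_eq[OF that, symmetric]])
  assume f: "f \<in> L2 ?M"
  \<comment> \<open>Conjugation in the second argument turns \<open>cnj (snd i \<xi>)\<close> into
    \<open>snd i \<xi>\<close> and leaves the real factors alone, so the coefficients at all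
    \<open>\<xi>\<close> come from one polynomial that does not depend on
    \<open>\<xi>\<close>.\<close>
  define c where "c = (\<lambda>i. complex_of_real (\<alpha> (fst i)) * L2_inner ?M f (snd i))"
  define p where "p = (\<lambda>x. \<Sum>i\<in>?I. c i * snd i x)"
  have p: "p \<in> polys N"
    unfolding p_def by (intro polys_lincomb) (auto intro: polys_mono[OF orth_basisD(2)[OF E]])
  have inner: "L2_inner ?M f (needlet \<mu> a lam (j, \<xi>)) = complex_of_real (sqrt (lam j \<xi>)) * p \<xi>"
    if "\<xi> \<in> X j" for \<xi>
  proof -
    have "L2_inner ?M f (needlet \<mu> a lam (j, \<xi>)) = L2_inner ?M f (\<psi> \<xi>)"
      unfolding L2_inner_def using \<psi>_eq[OF that] by (intro Bochner_Integration.integral_cong) simp_all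
    also have "\<dots> = (\<Sum>i\<in>?I. cnj (complex_of_real (sqrt (lam j \<xi>) * \<alpha> (fst i)) * cnj (snd i \<xi>)) * L2_inner ?M f (snd i))"
      unfolding \<psi>_def using f by (intro L2_inner_lincomb_right orthonormal_onD(2)[OF on])
    also have "\<dots> = complex_of_real (sqrt (lam j \<xi>)) * p \<xi>"
      by (simp add: p_def c_def sum_distrib_left ac_simps)
    finally show ?thesis .
  qed
  have "complex_of_real (\<Sum>\<xi>\<in>X j. (cmod (L2_inner ?M f (needlet \<mu> a lam (j, \<xi>))))\<^sup>2) =
      (\<Sum>\<xi>\<in>X j. complex_of_real (lam j \<xi>) * (p \<xi> * cnj (p \<xi>)))"
    unfolding of_real_sum
  proof (rule sum.cong[OF refl])
    fix \<xi> assume \<xi>: "\<xi> \<in> X j"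
    have "(cmod (L2_inner ?M f (needlet \<mu> a lam (j, \<xi>))))\<^sup>2 = lam j \<xi> * (cmod (p \<xi>))\<^sup>2"
      using lam[OF \<xi>] by (simp add: inner[OF \<xi>] norm_mult power_mult_distrib)
    then show "complex_of_real ((cmod (L2_inner ?M f (needlet \<mu> a lam (j, \<xi>))))\<^sup>2) =
        complex_of_real (lam j \<xi>) * (p \<xi> * cnj (p \<xi>))"
      by (simp only: of_real_mult complex_norm_square)
  qed
  also have "\<dots> = (LINT x|?M. p x * cnj (p x))"
    using polys_mono[OF polys_mult[OF p polys_cnj[OF p]] N] by (rule quad[symmetric])
  also have "\<dots> = complex_of_real ((L2_norm ?M p)\<^sup>2)"
    using L2_inner_self[of ?M p] by (simp add: L2_inner_def)
  also have "(L2_norm ?M p)\<^sup>2 = (\<Sum>i\<in>?I. (cmod (c i))\<^sup>2)"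
    unfolding p_def by (rule orthonormal_norm_lincomb[OF on])
  also have "\<dots> = (\<Sum>\<nu>\<le>N. \<Sum>e\<in>E \<nu>. (\<alpha> \<nu>)\<^sup>2 * (cmod (L2_inner ?M f e))\<^sup>2)"
    by (subst sum.Sigma) (simp_all add: orth_basisD(5)[OF E] split_beta c_def norm_mult power_mult_distrib)
  finally show "(\<Sum>\<xi>\<in>X j. (cmod (L2_inner ?M f (needlet \<mu> a lam (j, \<xi>))))\<^sup>2) =
      (\<Sum>\<nu>\<le>N. (\<alpha> \<nu>)\<^sup>2 * (\<Sum>e\<in>E \<nu>. (cmod (L2_inner ?M f e))\<^sup>2))"
    unfolding of_real_eq_iff by (simp add: sum_distrib_left)
qed

text \<open>Summed over levels, each degree carries a weight between 0 and 1 that equals 1 for all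
  low degrees. The sums are thus squeezed between a partial Parseval sum and the squared
  norm.\<close>

lemma needlet_level_sums:
  fixes f :: "real ^ 'd \<Rightarrow> complex"
  assumes a: "needlet_cutoff a" and cub: "needlet_cubature \<mu> c\<^sub>1 c\<^sub>2 c\<^sub>3 X lam"
    and f: "f \<in> L2 (weighted \<mu>)"
  defines "T \<equiv> (\<lambda>n. \<Sum>j<n. \<Sum>\<xi>\<in>X j. (cmod (L2_inner (weighted \<mu>) f (needlet \<mu> a lam (j, \<xi>))))\<^sup>2)"
  shows "T \<longlonglongrightarrow> (L2_norm (weighted \<mu>) f)\<^sup>2" and "\<xi> \<in> X j \<Longrightarrow> needlet \<mu> a lam (j, \<xi>) \<in> L2 (weighted \<mu>)"
proof -
  let ?M = "weighted \<mu> :: (real ^ 'd) measure"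
  note fin = needlet_cubature_finite_measure(1)[OF cub]
  have b: "ball_const TYPE('d) \<mu> \<noteq> 0"
    using needlet_cubature_finite_measure(2)[OF cub] by simp
  obtain E :: "nat \<Rightarrow> (real ^ 'd \<Rightarrow> complex) set" where E: "\<And>n. orth_basis \<mu> n (E n)"
    using orth_basis_exists[OF fin] by metis
  note kernel = needlet_kernel_expansion[OF fin b E a]
  note level0 = needlet_level[OF fin E cub, of 0 0 a "\<lambda>_. 1"]
  note levelS = needlet_level[OF fin E cub, of "2 ^ Suc k" "Suc k" a "\<lambda>\<nu>. a (real \<nu> / 2 ^ k)" for k]
  show "needlet \<mu> a lam (j, \<xi>) \<in> L2 ?M" if "\<xi> \<in> X j"
  proof (cases j)
    case 0
    then show ?thesis
      using level0(1) kernel(1) that by simp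
  next
    case (Suc k)
    then show ?thesis
      using levelS(1)[of k] kernel(2)[of _ _ k] that by simp
  qed
  define s where "s = (\<lambda>\<nu>. \<Sum>e\<in>E \<nu>. (cmod (L2_inner ?M f e))\<^sup>2)"
  have s_nonneg: "0 \<le> s \<nu>" for \<nu>
    unfolding s_def by (intro sum_nonneg) simp
  have T0: "(\<Sum>\<xi>\<in>X 0. (cmod (L2_inner ?M f (needlet \<mu> a lam (0, \<xi>))))\<^sup>2) = s 0"
    using level0(2)[OF _ _ f] kernel(1) by (simp add: s_def)
  have TS: "(\<Sum>\<xi>\<in>X (Suc k). (cmod (L2_inner ?M f (needlet \<mu> a lam (Suc k, \<xi>))))\<^sup>2) =
      (\<Sum>\<nu>\<le>2 ^ Suc k. (a (real \<nu> / 2 ^ k))\<^sup>2 * s \<nu>)" for k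
    using levelS(2)[of k, OF _ _ f] kernel(2)[of _ _ k] by (simp add: s_def)
  \<comment> \<open>The indicator of degree 0 is the share of level 0. Every dilated cutoff vanishes
    at 0, so no other level contributes to the constants.\<close>
  define w where "w = (\<lambda>n \<nu>. (\<Sum>k<n. (a (real \<nu> / 2 ^ k))\<^sup>2) + (if \<nu> = 0 then 1 else 0))"
  have w_nonneg: "0 \<le> w n \<nu>" for n \<nu>
    unfolding w_def by (intro add_nonneg_nonneg sum_nonneg) auto
  have w_le: "w n \<nu> \<le> 1" for n \<nu>
    using cutoff_sum_le[OF a, of "real \<nu>" n] cutoff_zero[OF a, of 0] by (cases "\<nu> = 0") (auto simp: w_def)
  have w_eq: "w (Suc n) \<nu> = 1" if "\<nu> \<le> 2 ^ n" for n \<nu>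
  proof (cases "\<nu> = 0")
    case True
    then show ?thesis
      using cutoff_zero[OF a, of 0] by (simp add: w_def)
  next
    case False
    have "real \<nu> \<le> 2 ^ n"
      using of_nat_mono[OF that, where 'a = real] by simp
    then show ?thesis
      using False cutoff_sum_eq[OF a, of "real \<nu>" n] unfolding w_def by simp
  qed
  \<comment> \<open>\<open>T (Suc n)\<close> collects level 0 and the levels \<open>Suc k\<close>
    with \<open>k < n\<close>, all of degree at most \<open>2 ^ n\<close>; this is the common range
    to which the inner sums are extended by zeros.\<close>
  have T_eq: "T (Suc n) = (\<Sum>\<nu>\<le>2 ^ n. w n \<nu> * s \<nu>)" for n
  proof -
    have ext: "(\<Sum>\<nu>\<le>2 ^ Suc k. (a (real \<nu> / 2 ^ k))\<^sup>2 * s \<nu>) = (\<Sum>\<nu>\<le>2 ^ n. (a (real \<nu> / 2 ^ k))\<^sup>2 * s \<nu>)"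
      if "k < n" for k
    proof (rule sum.mono_neutral_left)
      show "{..2 ^ Suc k} \<subseteq> {..(2::nat) ^ n}"
        using that by (simp del: power_Suc add: power_increasing)
      show "\<forall>\<nu>\<in>{..2 ^ n} - {..2 ^ Suc k}. (a (real \<nu> / 2 ^ k))\<^sup>2 * s \<nu> = 0"
      proof
        fix \<nu> assume "\<nu> \<in> {..(2::nat) ^ n} - {..2 ^ Suc k}"
        then have "real (2 ^ Suc k) \<le> real \<nu>"
          by (intro of_nat_mono) simp
        then have "2 \<le> real \<nu> / 2 ^ k"
          by (simp add: field_simps)
        then show "(a (real \<nu> / 2 ^ k))\<^sup>2 * s \<nu> = 0"
          using cutoff_zero[OF a, of "real \<nu> / 2 ^ k"] by simp
      qed
    qed simp
    have "T (Suc n) = s 0 + (\<Sum>k<n. \<Sum>\<nu>\<le>2 ^ n. (a (real \<nu> / 2 ^ k))\<^sup>2 * s \<nu>)"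
      unfolding T_def sum.lessThan_Suc_shift T0 TS using ext by simp
    also have "\<dots> = s 0 + (\<Sum>\<nu>\<le>2 ^ n. (\<Sum>k<n. (a (real \<nu> / 2 ^ k))\<^sup>2) * s \<nu>)"
      by (subst sum.swap) (simp add: sum_distrib_right)
    also have "s 0 = (\<Sum>\<nu>\<le>(2::nat) ^ n. (if \<nu> = 0 then 1 else 0) * s \<nu>)"
      by (subst sum.mono_neutral_right[of _ "{0}"]) auto
    finally show ?thesis
      by (simp add: w_def distrib_right sum.distrib)
  qed
  have "(\<lambda>N. \<Sum>\<nu>\<le>N. s \<nu>) \<longlonglongrightarrow> (L2_norm ?M f)\<^sup>2"
    unfolding s_def by (rule orth_basis_parseval[OF fin E f])
  then have lower: "(\<lambda>n. \<Sum>\<nu>\<le>2 ^ n. s \<nu>) \<longlonglongrightarrow> (L2_norm ?M f)\<^sup>2"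
    by (rule filterlim_compose) (rule filterlim_at_top_mono[OF filterlim_ident], simp add: less_imp_le)
  \<comment> \<open>The double successor brings in the weights \<open>w (Suc n)\<close>, which are
    known to be 1 up to degree \<open>2 ^ n\<close>.\<close>
  have "(\<lambda>n. T (Suc (Suc n))) \<longlonglongrightarrow> (L2_norm ?M f)\<^sup>2"
  proof (rule tendsto_sandwich[OF _ _ lower tendsto_const])
    have "(\<Sum>\<nu>\<le>2 ^ n. s \<nu>) \<le> T (Suc (Suc n))" for n
    proof -
      have "(\<Sum>\<nu>\<le>2 ^ n. s \<nu>) = (\<Sum>\<nu>\<le>2 ^ n. w (Suc n) \<nu> * s \<nu>)"
        by (simp add: w_eq)
      also have "\<dots> \<le> T (Suc (Suc n))"
        unfolding T_eq using w_nonneg s_nonneg by (intro sum_mono2) auto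
      finally show ?thesis .
    qed
    then show "eventually (\<lambda>n. (\<Sum>\<nu>\<le>2 ^ n. s \<nu>) \<le> T (Suc (Suc n))) sequentially"
      by simp
    have "T (Suc (Suc n)) \<le> (L2_norm ?M f)\<^sup>2" for n
    proof -
      have "T (Suc (Suc n)) \<le> (\<Sum>\<nu>\<le>2 ^ Suc n. s \<nu>)"
        unfolding T_eq using w_le s_nonneg by (intro sum_mono) (simp add: mult_left_le_one_le w_nonneg)
      also have "\<dots> \<le> (L2_norm ?M f)\<^sup>2"
        unfolding s_def by (rule orth_basis_bessel[OF E f])
      finally show ?thesis .
    qed
    then show "eventually (\<lambda>n. T (Suc (Suc n)) \<le> (L2_norm ?M f)\<^sup>2) sequentially"
      by simp
  qed
  then show "T \<longlonglongrightarrow> (L2_norm ?M f)\<^sup>2"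
    by (simp only: filterlim_sequentially_Suc[where f = "\<lambda>n. T (Suc n)"] filterlim_sequentially_Suc[where f = T])
qed

text \<open>For nonnegative terms every finite subset is swallowed by some \<open>F n\<close>, so
  convergence along one exhaustion already gives the unordered sum. The second claim later yields
  Bessel's inequality over arbitrary finite sets of needlets.\<close>

lemma has_sum_exhaustion:
  fixes g :: "'a \<Rightarrow> real"
  assumes nonneg: "\<And>i. i \<in> A \<Longrightarrow> 0 \<le> g i" and F: "\<And>n. finite (F n)" "incseq F" "(\<Union>n. F n) = A"
    and lim: "(\<lambda>n. sum g (F n)) \<longlonglongrightarrow> L"
  shows "(g has_sum L) A" and "finite B \<Longrightarrow> B \<subseteq> A \<Longrightarrow> sum g B \<le> L"
proof -
  have FA: "F n \<subseteq> A" for n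
    using F(3) by blast
  have "incseq (\<lambda>n. sum g (F n))"
    using F(1) monoD[OF F(2)] nonneg FA by (intro monoI sum_mono2) blast+
  then have F_le: "sum g (F n) \<le> L" for n
    using lim by (rule incseq_le)
  show le: "sum g B \<le> L" if "finite B" "B \<subseteq> A" for B
  proof -
    have "\<exists>n. B \<subseteq> F n"
      using that
    proof (induction B)
      case (insert b B)
      then obtain m n where "b \<in> F m" "B \<subseteq> F n"
        using F(3) by blast
      then have "insert b B \<subseteq> F (max m n)"
        using monoD[OF F(2), of m "max m n"] monoD[OF F(2), of n "max m n"] by auto
      then show ?case ..
    qed simp
    then obtain n where "B \<subseteq> F n" ..
    then have "sum g B \<le> sum g (F n)"
      using F(1) FA nonneg by (intro sum_mono2) blast+
    then show ?thesis
      using F_le order_trans by blast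
  qed
  show "(g has_sum L) A"
    unfolding has_sum_def
  proof (rule order_tendstoI)
    fix c assume "c < L"
    then obtain n where n: "c < sum g (F n)"
      using order_tendstoD(1)[OF lim] eventually_happens'[OF sequentially_bot] by blast
    show "eventually (\<lambda>B. c < sum g B) (finite_subsets_at_top A)"
      unfolding eventually_finite_subsets_at_top
    proof (intro exI[of _ "F n"] conjI allI impI)
      fix B assume B: "finite B \<and> F n \<subseteq> B \<and> B \<subseteq> A"
      then have "sum g (F n) \<le> sum g B"
        using nonneg by (intro sum_mono2) auto
      then show "c < sum g B"
        using n by simp
    qed (use F FA in auto)
  next
    fix c assume "L < c"
    then show "eventually (\<lambda>B. sum g B < c) (finite_subsets_at_top A)"
      unfolding eventually_finite_subsets_at_top
      by (intro exI[of _ "{}"]) (use le in \<open>auto intro: le_less_trans\<close>)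
  qed
qed

text \<open>Stated for an arbitrary filter, to serve both the sequence of levels and the net of
  finite index sets.\<close>

lemma tendsto_zero_of_power2_le:
  fixes N G :: "'a \<Rightarrow> real"
  assumes "(G \<longlongrightarrow> L) \<F>" "eventually (\<lambda>x. (N x)\<^sup>2 \<le> L - G x) \<F>" "\<And>x. 0 \<le> N x"
  shows "(N \<longlongrightarrow> 0) \<F>"
proof -
  have "((\<lambda>x. L - G x) \<longlongrightarrow> L - L) \<F>"
    by (intro tendsto_intros assms)
  then have "((\<lambda>x. (N x)\<^sup>2) \<longlongrightarrow> 0) \<F>"
    by (intro tendsto_sandwich[OF _ assms(2) tendsto_const]) auto
  from tendsto_real_sqrt[OF this] show ?thesis
    using assms(3) by simp
qed

theorem theorem6p1:
  fixes \<mu> c\<^sub>1 c\<^sub>2 c\<^sub>3 :: real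
    and a :: "real \<Rightarrow> real"
    and X :: "nat \<Rightarrow> (real ^ 'd) set"
    and lam :: "nat \<Rightarrow> real ^ 'd \<Rightarrow> real"
    and f :: "real ^ 'd \<Rightarrow> complex"
  assumes "CARD('d) > 1"
    and "\<mu> \<ge> 0"
    and "needlet_cutoff a"
    and "c\<^sub>1 > 0" and "c\<^sub>2 > 0" and "c\<^sub>3 > 0"
    and "needlet_cubature \<mu> c\<^sub>1 c\<^sub>2 c\<^sub>3 X lam"
    and "f \<in> L2 (weighted \<mu>)"
  shows "((\<lambda>n. L2_norm (weighted \<mu>) (\<lambda>x. f x -
            (\<Sum>j<n. \<Sum>\<xi>\<in>X j. L2_inner (weighted \<mu>) f (needlet \<mu> a lam (j, \<xi>)) * needlet \<mu> a lam (j, \<xi>) x)))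
          \<longlonglongrightarrow> 0)
     \<and> ((\<lambda>F. L2_norm (weighted \<mu>) (\<lambda>x. f x -
            (\<Sum>i\<in>F. L2_inner (weighted \<mu>) f (needlet \<mu> a lam i) * needlet \<mu> a lam i x)))
          \<longlongrightarrow> 0) (finite_subsets_at_top (needlet_index X))
     \<and> (\<lambda>i. (cmod (L2_inner (weighted \<mu>) f (needlet \<mu> a lam i)))\<^sup>2) summable_on needlet_index X
     \<and> L2_norm (weighted \<mu>) f =
          sqrt (\<Sum>\<^sub>\<infinity>i\<in>needlet_index X. (cmod (L2_inner (weighted \<mu>) f (needlet \<mu> a lam i)))\<^sup>2)"
proof -
  let ?M = "weighted \<mu> :: (real ^ 'd) measure"
  let ?\<psi> = "needlet \<mu> a lam"
  note a = assms(3) and cub = assms(7) and f = assms(8)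
  have fX: "finite (X j)" for j
    using cub by (simp add: needlet_cubature_def)
  \<comment> \<open>Generic in the type of the summands, since it rewrites both the real sums of
    squares and the complex expansions.\<close>
  have sum_levels: "(\<Sum>i\<in>Sigma {..<n} X. h i) = (\<Sum>j<n. \<Sum>\<xi>\<in>X j. h (j, \<xi>))"
    for n and h :: "nat \<times> (real ^ 'd) \<Rightarrow> 'b::comm_monoid_add"
    using fX by (subst sum.Sigma) auto
  have exhaust: "\<And>n. finite (Sigma {..<n} X)" "incseq (\<lambda>n. Sigma {..<n} X)"
    "(\<Union>n. Sigma {..<n} X) = needlet_index X"
    using fX by (auto simp: needlet_index_def incseq_def)
  have \<psi>L: "?\<psi> i \<in> L2 ?M" if "i \<in> needlet_index X" for i
    using that needlet_level_sums(2)[OF a cub f] by (auto simp: needlet_index_def)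
  have lim: "(\<lambda>n. \<Sum>i\<in>Sigma {..<n} X. (cmod (L2_inner ?M h (?\<psi> i)))\<^sup>2) \<longlonglongrightarrow> (L2_norm ?M h)\<^sup>2"
    if "h \<in> L2 ?M" for h
    unfolding sum_levels by (rule needlet_level_sums(1)[OF a cub that])
  have parseval: "((\<lambda>i. (cmod (L2_inner ?M f (?\<psi> i)))\<^sup>2) has_sum (L2_norm ?M f)\<^sup>2) (needlet_index X)"
    by (rule has_sum_exhaustion(1)[OF _ exhaust lim[OF f]]) simp
  \<comment> \<open>Stated for every \<open>h\<close>, because the remainder estimate applies it to
    finite combinations of the needlets themselves.\<close>
  have bessel: "(\<Sum>i\<in>F. (cmod (L2_inner ?M h (?\<psi> i)))\<^sup>2) \<le> (L2_norm ?M h)\<^sup>2"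
    if "h \<in> L2 ?M" "finite F" "F \<subseteq> needlet_index X" for h F
    by (rule has_sum_exhaustion(2)[OF _ exhaust lim[OF that(1)] that(2,3)]) simp
  have remainder: "(L2_norm ?M (\<lambda>x. f x - (\<Sum>i\<in>F. L2_inner ?M f (?\<psi> i) * ?\<psi> i x)))\<^sup>2 \<le>
      (L2_norm ?M f)\<^sup>2 - (\<Sum>i\<in>F. (cmod (L2_inner ?M f (?\<psi> i)))\<^sup>2)"
    if "finite F" "F \<subseteq> needlet_index X" for F
    using that \<psi>L f bessel by (intro frame_remainder_bound) auto
  \<comment> \<open>Summation level by level is summation over the finite sets
    \<open>Sigma {..<n} X\<close>, so the same remainder estimate covers both modes of
    convergence.\<close>
  have "(\<lambda>n. L2_norm ?M (\<lambda>x. f x - (\<Sum>i\<in>Sigma {..<n} X. L2_inner ?M f (?\<psi> i) * ?\<psi> i x))) \<longlonglongrightarrow> 0"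
    using exhaust by (intro tendsto_zero_of_power2_le[OF lim[OF f]] always_eventually allI remainder L2_norm_nonneg) auto
  moreover have "((\<lambda>F. L2_norm ?M (\<lambda>x. f x - (\<Sum>i\<in>F. L2_inner ?M f (?\<psi> i) * ?\<psi> i x))) \<longlongrightarrow> 0)
      (finite_subsets_at_top (needlet_index X))"
    using parseval remainder unfolding has_sum_def
    by (intro tendsto_zero_of_power2_le[OF _ eventually_finite_subsets_at_top_weakI] L2_norm_nonneg)
  ultimately show ?thesis
    using has_sum_imp_summable[OF parseval] infsumI[OF parseval]
    unfolding sum_levels by (simp add: L2_norm_nonneg)
qed

end
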